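(* Let $H$ be a separable real Hilbert space, $U\subset H$ a closed subspace, and $Q\in L(H)$ a nonnegative self-adjoint nuclear operator such that $U$ and $U^\perp$ are $Q$-invariant. Consider the statistical model $(\mathbb{P}_\vartheta)_{\vartheta\in\Theta}$ on $H$ with $\Theta=U\times(0,\infty)$ and $\mathbb{P}_\vartheta=\mathrm{N}(\zeta,\sigma^2Q)$ for $\vartheta=(\zeta,\sigma)$, with observation $Y$, and let $\widehat{\zeta}(Y):=\Pi_UY$. Assume $Q(\Pi_H-\Pi_U)\neq0$ and set $$\tau:=\operatorname{tr}(Q(\Pi_H-\Pi_U)),\qquad \lambda:=\|Q(\Pi_H-\Pi_U)\|,\qquad n:=\dim\ker(\lambda-Q(\Pi_H-\Pi_U)).$$ Let $\widehat{s}(Y)\ge0$ be given by $$\widehat{s}^2(Y)=\frac{\|Y-\widehat{\zeta}(Y)\|^2}{\operatorname{tr}(Q(\Pi_H-\Pi_U))}.$$ Let $b\in H$ with $\langle Qb,\Pi_Ub\rangle>0$ and $\alpha\in(0,1)$ be arbitrary. Then the random interval $$\langle b,\widehat{\zeta}(Y)\rangle\pm\sqrt{\frac{\tau}{\lambda n}}\,t_{n,1-\frac{\alpha}{2}}\,\widehat{s}(Y)\sqrt{\langle Qb,\Pi_Ub\rangle}$$ is a $(1-\alpha)$-confidence interval for $\langle b,\zeta\rangle$.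
   Context: A subspace $V$ is $Q$-invariant if $Q(V)\subset V$. $\Pi_V$ is the orthogonal projection onto a closed subspace $V$; $\Pi_H$ is the identity, and $\lambda-Q(\Pi_H-\Pi_U)$ means $\lambda\Pi_H-Q(\Pi_H-\Pi_U)$. $\mathrm{N}(\zeta,\sigma^2Q)$ is the Gaussian measure on $H$ with mean $\zeta$ and covariance operator $\sigma^2Q$, i.e. if $Y$ has this law then $\langle b,Y\rangle\sim\mathrm{N}(\langle b,\zeta\rangle,\sigma^2\langle Qb,b\rangle)$ (possibly degenerate) for all $b\in H$. $Y$ is the observation (the identity map on $H$), so $Y\sim\mathrm{N}(\zeta,\sigma^2Q)$ under $\mathbb{P}_\vartheta$. For $a\in(0,1)$, $t_{n,a}$ is the $a$-quantile of Student's $t$-distribution with $n$ degrees of freedom. The notation $x\pm r$ means the interval $[x-r,x+r]$. A random interval $I(Y)$ is a $(1-\alpha)$-confidence interval for $\langle b,\zeta\rangle$ if $\mathbb{P}_\vartheta(\langle b,\zeta\rangle\in I(Y))\ge1-\alpha$ for every $\vartheta=(\zeta,\sigma)\in\Theta$. *)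

theory Defs
  imports "HOL-Probability.Probability"
begin

text \<open>
  Separable real Hilbert spaces are the types of sort
  \<open>{real_inner, polish_space}\<close> (complete and second countable inner product spaces).
\<close>

subsection \<open>Operators on a Hilbert space\<close>

text \<open>On a closed subspace of a complete space the point below exists and is unique.\<close>

definition orth_proj :: "'a::real_inner set \<Rightarrow> 'a \<Rightarrow> 'a"
  where "orth_proj V x = (THE y. y \<in> V \<and> x - y \<in> orthogonal_comp V)"

definition invariant_under :: "('a \<Rightarrow> 'a) \<Rightarrow> 'a set \<Rightarrow> bool"
  where "invariant_under Q V \<longleftrightarrow> Q ` V \<subseteq> V"

definition self_adjoint :: "('a::real_inner \<Rightarrow> 'a) \<Rightarrow> bool"
  where "self_adjoint T \<longleftrightarrow> (\<forall>x y. inner (T x) y = inner x (T y))"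

definition nonneg_operator :: "('a::real_inner \<Rightarrow> 'a) \<Rightarrow> bool"
  where "nonneg_operator T \<longleftrightarrow> (\<forall>x. 0 \<le> inner (T x) x)"

definition nuclear :: "('a::real_inner \<Rightarrow> 'a) \<Rightarrow> bool"
  where "nuclear T \<longleftrightarrow> bounded_linear T \<and>
    (\<exists>u v :: nat \<Rightarrow> 'a. summable (\<lambda>k. norm (u k) * norm (v k)) \<and>
       (\<forall>x. (\<lambda>k. inner (u k) x *\<^sub>R v k) sums T x))"

definition orthonormal_basis :: "'a::real_inner set \<Rightarrow> bool"
  where "orthonormal_basis B \<longleftrightarrow>
    pairwise orthogonal B \<and> (\<forall>e\<in>B. norm e = 1) \<and> closure (span B) = UNIV"

text \<open>
  For a nuclear operator on a Hilbert space the sum converges absolutely and does not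
  depend on the orthonormal basis, so the choice of basis is immaterial.
\<close>

definition operator_trace :: "('a::real_inner \<Rightarrow> 'a) \<Rightarrow> real"
  where "operator_trace T = (\<Sum>\<^sub>\<infinity>e\<in>(SOME B. orthonormal_basis B). inner (T e) e)"

subsection \<open>Gaussian measures\<close>

text \<open>The second parameter is the variance; variance zero gives a point mass.\<close>

definition normal_law :: "real \<Rightarrow> real \<Rightarrow> real measure"
  where "normal_law m v =
    (if v = 0 then return borel m
     else density lborel (\<lambda>x. ennreal (normal_density m (sqrt v) x)))"

definition gaussian_measure ::
    "'a::{real_inner, polish_space} measure \<Rightarrow> 'a \<Rightarrow> ('a \<Rightarrow> 'a) \<Rightarrow> bool"
  where "gaussian_measure M \<zeta> C \<longleftrightarrow> prob_space M \<and> sets M = sets borel \<and>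
    (\<forall>b. distr M borel (\<lambda>y. inner b y) = normal_law (inner b \<zeta>) (inner (C b) b))"

subsection \<open>Student's distribution\<close>

definition student_t_density :: "nat \<Rightarrow> real \<Rightarrow> real"
  where "student_t_density n x =
    Gamma ((real n + 1) / 2) / (sqrt (real n * pi) * Gamma (real n / 2)) *
    (1 + x\<^sup>2 / real n) powr (- (real n + 1) / 2)"

definition student_t :: "nat \<Rightarrow> real measure"
  where "student_t n = density lborel (\<lambda>x. ennreal (student_t_density n x))"

definition quantile :: "real measure \<Rightarrow> real \<Rightarrow> real"
  where "quantile M a = Inf {x. a \<le> cdf M x}"

definition t_quantile :: "nat \<Rightarrow> real \<Rightarrow> real"
  where "t_quantile n a = quantile (student_t n) a"

subsection \<open>Confidence intervals\<close>

definition pm_interval :: "real \<Rightarrow> real \<Rightarrow> real set"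
  where "pm_interval x r = {x - r..x + r}"

definition confidence_interval ::
    "'p set \<Rightarrow> ('p \<Rightarrow> 'a measure) \<Rightarrow> ('p \<Rightarrow> real) \<Rightarrow> ('a \<Rightarrow> real set) \<Rightarrow> real \<Rightarrow> bool"
  where "confidence_interval \<Theta> P g I c \<longleftrightarrow>
    (\<forall>\<theta>\<in>\<Theta>. {y \<in> space (P \<theta>). g \<theta> \<in> I y} \<in> sets (P \<theta>) \<and> c \<le> \<P>(y in P \<theta>. g \<theta> \<in> I y))"

end

theory Submission
  imports Defs
begin

text \<open>
  The error of the estimator is \<open>\<langle>b, \<Pi>\<^sub>U Y\<rangle> - \<langle>b, \<zeta>\<rangle> = \<langle>\<Pi>\<^sub>U b, Y - \<zeta>\<rangle>\<close>, a centred Gaussian variable of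
  variance \<open>\<sigma>\<^sup>2 \<langle>Q b, \<Pi>\<^sub>U b\<rangle>\<close>, because \<open>Q\<close> commutes with \<open>\<Pi>\<^sub>U\<close>. The interval measures it against the
  norm of the residual \<open>Y - \<Pi>\<^sub>U Y\<close>. The law of that norm depends on the whole spectrum of
  \<open>T = Q (\<Pi>\<^sub>H - \<Pi>\<^sub>U)\<close>, but the norm can be bounded below by looking only at the eigenspace of \<open>T\<close> for the
  largest eigenvalue \<open>\<lambda>\<close>. This eigenspace is contained in the orthogonal complement of \<open>U\<close>, so for an
  orthonormal basis \<open>e\<^sub>1, \<dots>, e\<^sub>n\<close> of it \<open>\<langle>e\<^sub>i, Y - \<Pi>\<^sub>U Y\<rangle> = \<langle>e\<^sub>i, Y - \<zeta>\<rangle>\<close> is centred Gaussian with variance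
  \<open>\<sigma>\<^sup>2 \<lambda>\<close>, and Bessel's inequality bounds \<open>\<parallel>Y - \<Pi>\<^sub>U Y\<parallel>\<^sup>2\<close> from below by the sum of the squares of these
  \<open>n\<close> variables. The vectors \<open>\<Pi>\<^sub>U b, e\<^sub>1, \<dots>, e\<^sub>n\<close> are pairwise orthogonal for the form
  \<open>\<langle>Q x, y\<rangle>\<close>, so the corresponding Gaussian variables are independent. Hence the error, divided by the norm
  of the \<open>n\<close> coordinates and suitably scaled, has exactly Student's distribution with \<open>n\<close> degrees of
  freedom, and replacing the \<open>n\<close> coordinates by the full residual can only widen the interval. The
  trace \<open>\<tau>\<close> cancels between the estimator of \<open>\<sigma>\<close> and the factor in front of it.

  Four ingredients carry the argument. \<open>onorm_eigenvector\<close>, \<open>eigenspace_orthonormal_basis\<close> and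
  \<open>operator_trace_pos\<close> make the statement meaningful: \<open>\<lambda>\<close> is an eigenvalue of finite multiplicity
  \<open>n \<ge> 1\<close>, and \<open>\<tau>\<close> is positive. \<open>gaussian_measure_iid_scores\<close> turns the one-dimensional marginals, which
  are all that the definition of a Gaussian measure mentions, into a joint law. \<open>distr_student_ratio\<close>
  computes the law of the ratio in polar coordinates, and \<open>student_t_central_interval\<close> translates
  the quantile into a coverage probability.
\<close>

section \<open>Orthogonal projections and orthonormal sets\<close>

text \<open>
  A sequence in \<open>U\<close> whose distances to \<open>x\<close> approach the infimum is Cauchy by the parallelogram identity, and its
  limit is a nearest point; moving from it along a vector of \<open>U\<close> that is not orthogonal to
  the difference would decrease the distance.
\<close>
lemma exists_orthogonal_projection:
  fixes U :: "'a::{real_inner, complete_space} set"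
  assumes U: "subspace U" "closed U"
  shows "\<exists>y\<in>U. x - y \<in> orthogonal_comp U"
proof -
  define D where "D = (INF a\<in>U. (norm (x - a))\<^sup>2)"
  have ne: "U \<noteq> {}" using U subspace_0 by auto
  have bdd: "bdd_below ((\<lambda>a. (norm (x - a))\<^sup>2) ` U)" by (rule bdd_belowI2[of _ 0]) auto
  have D: "D \<le> (norm (x - a))\<^sup>2" if "a \<in> U" for a
    unfolding D_def using bdd that by (rule cINF_lower)
  have "\<exists>a\<in>U. (norm (x - a))\<^sup>2 < D + 1 / real (Suc k)" for k
  proof -
    have "D < D + 1 / real (Suc k)" by simp
    then show ?thesis unfolding D_def using cINF_less_iff[OF ne bdd] by blast
  qed
  then obtain y where yU: "y k \<in> U" and y: "(norm (x - y k))\<^sup>2 < D + 1 / real (Suc k)" for k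
    by metis
  have parallelogram: "(norm (y j - y k))\<^sup>2 \<le> 2 / real (Suc j) + 2 / real (Suc k)" for j k
  proof -
    have "(1/2) *\<^sub>R (y j + y k) \<in> U" using U yU by (intro subspace_mul subspace_add)
    from D[OF this] have "4 * D \<le> 4 * (norm (x - (1/2) *\<^sub>R (y j + y k)))\<^sup>2" by simp
    also have "\<dots> = 2 * (norm (x - y j))\<^sup>2 + 2 * (norm (x - y k))\<^sup>2 - (norm (y j - y k))\<^sup>2"
      unfolding power2_norm_eq_inner
      by (simp add: inner_diff_left inner_diff_right inner_add_left inner_add_right inner_commute algebra_simps)
    finally show ?thesis using y[of j] y[of k] by simp
  qed
  have "Cauchy y"
  proof (rule metric_CauchyI)
    fix e :: real assume e: "e > 0"
    then obtain N where N: "1 / real (Suc N) < e\<^sup>2 / 4"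
      using nat_approx_posE[of "e\<^sup>2 / 4"] by auto
    have "dist (y j) (y k) < e" if "j \<ge> N" "k \<ge> N" for j k
    proof -
      have "1 / real (Suc j) \<le> 1 / real (Suc N)" "1 / real (Suc k) \<le> 1 / real (Suc N)"
        using that by (auto intro!: divide_left_mono)
      then have "(norm (y j - y k))\<^sup>2 < e\<^sup>2" using parallelogram[of j k] N by simp
      then show ?thesis using e by (simp add: dist_norm power_less_imp_less_base)
    qed
    then show "\<exists>M. \<forall>m\<ge>M. \<forall>n\<ge>M. dist (y m) (y n) < e" by blast
  qed
  then obtain z where z: "y \<longlonglongrightarrow> z" using Cauchy_convergent_iff convergent_def by blast
  have zU: "z \<in> U" using U(2) yU z closed_sequentially by blast
  have "(\<lambda>k. D + 1 / real (Suc k)) \<longlonglongrightarrow> D"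
    using tendsto_add[OF tendsto_const LIMSEQ_inverse_real_of_nat, of D] by (simp add: inverse_eq_divide)
  moreover have "(\<lambda>k. (norm (x - y k))\<^sup>2) \<longlonglongrightarrow> (norm (x - z))\<^sup>2" by (intro tendsto_intros z)
  ultimately have zD: "(norm (x - z))\<^sup>2 \<le> D"
    using y by (intro LIMSEQ_le) (auto intro!: exI[of _ 0] less_imp_le)
  have "inner u (x - z) = 0" if u: "u \<in> U" for u
  proof (rule ccontr)
    assume nz: "inner u (x - z) \<noteq> 0"
    then have u0: "inner u u > 0" by auto
    define s where "s = inner u (x - z) / inner u u"
    have "z + s *\<^sub>R u \<in> U" using U zU u by (intro subspace_mul subspace_add)
    from order_trans[OF zD D[OF this]] have "(norm (x - z))\<^sup>2 \<le> (norm (x - (z + s *\<^sub>R u)))\<^sup>2" .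
    also have "\<dots> = (norm (x - z))\<^sup>2 - 2 * s * inner u (x - z) + s * s * inner u u"
      unfolding power2_norm_eq_inner
      by (simp add: inner_diff_left inner_diff_right inner_add_left inner_add_right inner_commute algebra_simps)
    also have "s * s * inner u u = s * inner u (x - z)" using u0 by (simp add: s_def)
    finally have "s * inner u (x - z) \<le> 0" by simp
    moreover have "s * inner u (x - z) = (inner u (x - z))\<^sup>2 / inner u u"
      by (simp add: s_def power2_eq_square)
    moreover have "(inner u (x - z))\<^sup>2 / inner u u > 0" using nz u0 by (intro divide_pos_pos) auto
    ultimately show False by simp
  qed
  then show ?thesis using zU by (auto simp: orthogonal_comp_def orthogonal_def)
qed

lemma orth_proj_eqI:
  fixes U :: "'a::real_inner set"
  assumes U: "subspace U" and y: "y \<in> U" "x - y \<in> orthogonal_comp U"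
  shows "orth_proj U x = y"
  unfolding orth_proj_def
proof (rule the_equality)
  show "y \<in> U \<and> x - y \<in> orthogonal_comp U" using y by simp
  fix z assume z: "z \<in> U \<and> x - z \<in> orthogonal_comp U"
  have "z - y \<in> U" using U y z by (simp add: subspace_diff)
  moreover have "z - y \<in> orthogonal_comp U"
    using subspace_diff[OF subspace_orthogonal_comp, of "x - y" U "x - z"] y z by simp
  ultimately have "inner (z - y) (z - y) = 0" by (auto simp: orthogonal_comp_def orthogonal_def)
  then show "z = y" by simp
qed

context
  fixes U :: "'a::{real_inner, complete_space} set"
  assumes U: "subspace U" "closed U"
begin

lemma orth_proj_in: "orth_proj U x \<in> U" and orth_proj_compl: "x - orth_proj U x \<in> orthogonal_comp U"
  using exists_orthogonal_projection[OF U, of x] orth_proj_eqI[OF U(1), of _ x] by blast+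

lemma orth_proj_ident: "x \<in> U \<Longrightarrow> orth_proj U x = x"
  by (rule orth_proj_eqI[OF U(1)]) (simp_all add: subspace_0[OF subspace_orthogonal_comp])

lemma orth_proj_zero: "x \<in> orthogonal_comp U \<Longrightarrow> orth_proj U x = 0"
  by (rule orth_proj_eqI[OF U(1)]) (simp_all add: subspace_0[OF U(1)])

lemma inner_orth_proj_compl: "u \<in> U \<Longrightarrow> inner u (x - orth_proj U x) = 0"
  using orth_proj_compl[of x] by (auto simp: orthogonal_comp_def orthogonal_def)

lemma inner_orth_proj: "inner (orth_proj U x) y = inner (orth_proj U x) (orth_proj U y)"
  using inner_orth_proj_compl[OF orth_proj_in[of x], of y] by (simp add: inner_diff_right)

lemma inner_orth_proj_swap: "inner (orth_proj U x) y = inner x (orth_proj U y)"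
  using inner_orth_proj[of x y] inner_orth_proj[of y x] by (simp add: inner_commute)

lemma norm_orth_proj_le: "norm (orth_proj U x) \<le> norm x"
proof -
  have "(norm (orth_proj U x))\<^sup>2 = inner (orth_proj U x) x"
    using inner_orth_proj[of x x] by (simp add: power2_norm_eq_inner)
  also have "\<dots> \<le> norm (orth_proj U x) * norm x" by (rule norm_cauchy_schwarz)
  finally show ?thesis by (cases "norm (orth_proj U x) = 0") (auto simp: power2_eq_square)
qed

lemma bounded_linear_orth_proj: "bounded_linear (orth_proj U)"
proof (rule bounded_linear_intro[where K = 1])
  fix x y :: 'a and r :: real
  have "x + y - (orth_proj U x + orth_proj U y) \<in> orthogonal_comp U"
    using subspace_add[OF subspace_orthogonal_comp orth_proj_compl[of x] orth_proj_compl[of y]]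
    by (simp add: algebra_simps)
  then show "orth_proj U (x + y) = orth_proj U x + orth_proj U y"
    using U by (intro orth_proj_eqI subspace_add orth_proj_in)
  have "r *\<^sub>R x - r *\<^sub>R orth_proj U x \<in> orthogonal_comp U"
    using subspace_mul[OF subspace_orthogonal_comp orth_proj_compl[of x], of r]
    by (simp add: scaleR_diff_right)
  then show "orth_proj U (r *\<^sub>R x) = r *\<^sub>R orth_proj U x"
    using U by (intro orth_proj_eqI subspace_mul orth_proj_in)
qed (use norm_orth_proj_le in simp)

lemma norm_compl_orth_proj_le: "norm (x - orth_proj U x) \<le> norm x"
proof -
  have "(norm (x - orth_proj U x))\<^sup>2 = (norm x)\<^sup>2 - (norm (orth_proj U x))\<^sup>2"
    using inner_orth_proj[of x x] unfolding power2_norm_eq_inner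
    by (simp add: inner_diff_left inner_diff_right inner_commute)
  then have "(norm (x - orth_proj U x))\<^sup>2 \<le> (norm x)\<^sup>2" by simp
  then show ?thesis by (rule power2_le_imp_le) simp
qed

end

definition orthonormal_set :: "'a::real_inner set \<Rightarrow> bool"
  where "orthonormal_set B \<longleftrightarrow> pairwise orthogonal B \<and> (\<forall>e\<in>B. norm e = 1)"

lemma orthonormal_set_inner:
  "orthonormal_set B \<Longrightarrow> e \<in> B \<Longrightarrow> f \<in> B \<Longrightarrow> inner e f = (if e = f then 1 else 0)"
  unfolding orthonormal_set_def pairwise_def orthogonal_def by (simp add: norm_eq_1)

lemma orthonormal_set_subset: "orthonormal_set B \<Longrightarrow> C \<subseteq> B \<Longrightarrow> orthonormal_set C"
  unfolding orthonormal_set_def using pairwise_subset by blast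

lemma subspace_closure:
  fixes S :: "'a::real_normed_vector set"
  assumes "subspace S"
  shows "subspace (closure S)"
proof (rule subspaceI)
  show "0 \<in> closure S" using assms closure_subset subspace_0 by blast
  fix x y :: 'a and c :: real
  assume "x \<in> closure S"
  then obtain f where f: "\<And>n. f n \<in> S" "f \<longlonglongrightarrow> x" unfolding closure_sequential by blast
  show "c *\<^sub>R x \<in> closure S"
    unfolding closure_sequential using f assms
    by (intro exI[of _ "\<lambda>n. c *\<^sub>R f n"]) (auto intro!: tendsto_intros subspace_mul)
  assume "y \<in> closure S"
  then obtain g where g: "\<And>n. g n \<in> S" "g \<longlonglongrightarrow> y" unfolding closure_sequential by blast
  show "x + y \<in> closure S"
    unfolding closure_sequential using f g assms
    by (intro exI[of _ "\<lambda>n. f n + g n"]) (auto intro!: tendsto_intros subspace_add)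
qed

text \<open>
  An orthonormal set that is maximal by Zorn's lemma spans a dense subspace: otherwise the
  projection onto the closure of its span leaves a nonzero remainder, whose normalisation could
  be added.
\<close>
lemma exists_orthonormal_basis:
  "\<exists>B :: 'a::{real_inner, complete_space} set. orthonormal_basis B"
proof -
  have "\<exists>M\<in>Collect orthonormal_set. \<forall>X\<in>Collect orthonormal_set. M \<subseteq> X \<longrightarrow> X = (M :: 'a set)"
  proof (rule subset_Zorn')
    fix C :: "'a set set" assume "subset.chain (Collect orthonormal_set) C"
    then have C: "C \<subseteq> Collect orthonormal_set" "\<And>A B. A \<in> C \<Longrightarrow> B \<in> C \<Longrightarrow> A \<subseteq> B \<or> B \<subseteq> A"
      by (auto simp: subset_chain_def)
    have "orthogonal x y" if xy: "x \<in> A" "A \<in> C" "y \<in> B" "B \<in> C" "x \<noteq> y" for x y A B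
    proof -
      obtain D where "D \<in> C" "x \<in> D" "y \<in> D" using C(2)[of A B] xy by blast
      then show ?thesis using C(1) xy(5) by (auto simp: orthonormal_set_def pairwise_def)
    qed
    then show "\<Union>C \<in> Collect orthonormal_set"
      using C(1) by (auto simp: orthonormal_set_def pairwise_def)
  qed
  then obtain M :: "'a set" where M: "orthonormal_set M"
    and max: "\<And>X. orthonormal_set X \<Longrightarrow> M \<subseteq> X \<Longrightarrow> X = M" by auto
  let ?S = "closure (span M)"
  have S: "subspace ?S" "closed ?S" by (simp_all add: subspace_closure)
  have "x \<in> ?S" for x
  proof (rule ccontr)
    assume x: "x \<notin> ?S"
    let ?p = "orth_proj ?S x"
    have p: "?p \<in> ?S" and c: "x - ?p \<in> orthogonal_comp ?S"
      using S by (auto intro: orth_proj_in orth_proj_compl)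
    define e where "e = (x - ?p) /\<^sub>R norm (x - ?p)"
    have ne: "norm (x - ?p) \<noteq> 0" using p x by auto
    have orth: "inner m e = 0" if "m \<in> M" for m
    proof -
      have "m \<in> ?S" using that by (meson closure_subset span_base subsetD)
      then show ?thesis using c by (auto simp: e_def orthogonal_comp_def orthogonal_def)
    qed
    have "orthonormal_set (insert e M)"
      using M ne orth by (auto simp: orthonormal_set_def pairwise_insert orthogonal_def e_def inner_commute)
    then have "insert e M = M" using max by blast
    then have "inner e e = 0" using orth by blast
    then show False using ne by (simp add: e_def)
  qed
  then show ?thesis using M by (auto simp: orthonormal_basis_def orthonormal_set_def)
qed

lemma inner_sum_orthonormal:
  assumes "orthonormal_set F" "finite F"
  shows "inner (\<Sum>e\<in>F. f e *\<^sub>R e) (\<Sum>e\<in>F. g e *\<^sub>R e) = (\<Sum>e\<in>F. f e * g e)"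
proof -
  have "inner (\<Sum>e\<in>F. f e *\<^sub>R e) (\<Sum>e\<in>F. g e *\<^sub>R e) = (\<Sum>e\<in>F. \<Sum>d\<in>F. f e * (g d * inner e d))"
    unfolding inner_sum_left by (simp add: inner_sum_right sum_distrib_left mult.left_commute)
  also have "\<dots> = (\<Sum>e\<in>F. \<Sum>d\<in>F. if e = d then f e * g e else 0)"
    using assms by (intro sum.cong refl) (auto simp: orthonormal_set_inner)
  finally show ?thesis using assms by simp
qed

lemma bessel_inequality:
  assumes F: "orthonormal_set F" "finite F"
  shows "(\<Sum>e\<in>F. (inner e x)\<^sup>2) \<le> (norm x)\<^sup>2"
proof -
  let ?y = "\<Sum>e\<in>F. inner e x *\<^sub>R e"
  have yy: "inner ?y ?y = (\<Sum>e\<in>F. (inner e x)\<^sup>2)"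
    unfolding inner_sum_orthonormal[OF F] by (simp add: power2_eq_square)
  have xy: "inner x ?y = (\<Sum>e\<in>F. (inner e x)\<^sup>2)"
    by (simp add: inner_sum_right power2_eq_square inner_commute)
  have "0 \<le> inner (x - ?y) (x - ?y)" by simp
  also have "\<dots> = inner x x - 2 * inner x ?y + inner ?y ?y"
    by (simp add: inner_diff_left inner_diff_right inner_commute)
  finally show ?thesis using yy xy by (simp add: power2_norm_eq_inner)
qed

section \<open>Nonnegative nuclear operators\<close>

text \<open>
  For each term \<open>\<langle>u\<^sub>k, \<cdot>\<rangle> v\<^sub>k\<close> of a nuclear representation, the sum of \<open>\<langle>u\<^sub>k, e\<rangle> \<langle>v\<^sub>k, e\<rangle>\<close> over an orthonormal
  set is at most \<open>\<parallel>u\<^sub>k\<parallel> \<parallel>v\<^sub>k\<parallel>\<close> by the inequalities of Cauchy-Schwarz and Bessel. This one bound gives both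
  convergence of the trace and finite multiplicity of positive eigenvalues.
\<close>
lemma nuclear_orthonormal_sum_bounded:
  assumes "nuclear T"
  obtains C where "\<And>F. orthonormal_set F \<Longrightarrow> finite F \<Longrightarrow> (\<Sum>e\<in>F. inner (T e) e) \<le> C"
proof -
  from assms obtain u v :: "nat \<Rightarrow> 'a" where uv: "summable (\<lambda>k. norm (u k) * norm (v k))"
    and T: "\<And>x. (\<lambda>k. inner (u k) x *\<^sub>R v k) sums T x"
    unfolding nuclear_def by blast
  have "(\<Sum>e\<in>F. inner (T e) e) \<le> (\<Sum>k. norm (u k) * norm (v k))" if F: "orthonormal_set F" "finite F" for F
  proof -
    have "(\<lambda>k. inner (inner (u k) e *\<^sub>R v k) e) sums inner (T e) e" for e
      by (rule bounded_linear.sums[OF bounded_linear_inner_left T])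
    then have "(\<lambda>k. \<Sum>e\<in>F. inner (inner (u k) e *\<^sub>R v k) e) sums (\<Sum>e\<in>F. inner (T e) e)"
      by (intro sums_sum)
    moreover have "(\<Sum>e\<in>F. inner (inner (u k) e *\<^sub>R v k) e) \<le> norm (u k) * norm (v k)" for k
    proof -
      have "(\<Sum>e\<in>F. inner (inner (u k) e *\<^sub>R v k) e) = inner (\<Sum>e\<in>F. inner e (u k) *\<^sub>R e) (v k)"
        unfolding inner_sum_left by (simp add: inner_commute)
      also have "\<dots> \<le> norm (\<Sum>e\<in>F. inner e (u k) *\<^sub>R e) * norm (v k)" by (rule norm_cauchy_schwarz)
      also have "norm (\<Sum>e\<in>F. inner e (u k) *\<^sub>R e) \<le> norm (u k)"
      proof (rule power2_le_imp_le)
        have "(norm (\<Sum>e\<in>F. inner e (u k) *\<^sub>R e))\<^sup>2 = (\<Sum>e\<in>F. (inner e (u k))\<^sup>2)"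
          unfolding power2_norm_eq_inner inner_sum_orthonormal[OF F] by (simp add: power2_eq_square)
        then show "(norm (\<Sum>e\<in>F. inner e (u k) *\<^sub>R e))\<^sup>2 \<le> (norm (u k))\<^sup>2"
          using bessel_inequality[OF F, of "u k"] by simp
      qed simp
      finally show ?thesis by (simp add: mult_right_mono)
    qed
    ultimately show ?thesis using uv by (intro sums_le[OF _ _ summable_sums]) auto
  qed
  then show ?thesis by (rule that)
qed

text \<open>
  The nonnegative form \<open>\<langle>T z, z\<rangle>\<close> at \<open>z = x + s T x\<close> is \<open>2 s \<parallel>T x\<parallel>\<^sup>2 + O(s\<^sup>2)\<close> when it vanishes at \<open>x\<close>, which
  is negative for a small negative \<open>s\<close> unless \<open>T x = 0\<close>.
\<close>
lemma nonneg_operator_form_zeroD: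
  assumes T: "bounded_linear T" "self_adjoint T" "nonneg_operator T" and x: "inner (T x) x = 0"
  shows "T x = 0"
proof (rule ccontr)
  assume "T x \<noteq> 0"
  then have p: "inner (T x) (T x) > 0" by simp
  interpret T: bounded_linear T by fact
  let ?c = "inner (T (T x)) (T x)"
  have c: "?c \<ge> 0" using T(3) by (simp add: nonneg_operator_def)
  \<comment> \<open>The added \<open>1\<close> keeps the denominator positive when \<open>?c = 0\<close>.\<close>
  define s where "s = - inner (T x) (T x) / (?c + 1)"
  have "0 \<le> inner (T (x + s *\<^sub>R T x)) (x + s *\<^sub>R T x)"
    using T(3) by (simp add: nonneg_operator_def)
  also have "\<dots> = inner (T x) x + s * inner (T x) (T x) + s * inner (T (T x)) x + s * s * ?c"
    by (simp add: T.add T.scaleR inner_add_left inner_add_right algebra_simps)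
  also have "inner (T (T x)) x = inner (T x) (T x)" using T(2) by (simp add: self_adjoint_def)
  finally have "0 \<le> s * (2 * inner (T x) (T x) + s * ?c)" using x by (simp add: algebra_simps)
  moreover have "s < 0" using p c by (simp add: s_def divide_neg_pos)
  moreover have "2 * inner (T x) (T x) + s * ?c > 0"
  proof -
    have "inner (T x) (T x) * (?c / (?c + 1)) \<le> inner (T x) (T x) * 1"
      using p c by (intro mult_left_mono) auto
    then have "- s * ?c \<le> inner (T x) (T x)" by (simp add: s_def)
    then show ?thesis using p by linarith
  qed
  ultimately show False by (simp add: zero_le_mult_iff)
qed

text \<open>
  The trace is an infinite sum, whose value would be \<open>0\<close> if the family were not summable; so positivity needs
  the uniform bound on finite partial sums as well as one basis vector that \<open>T\<close> does not kill.
\<close>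
lemma operator_trace_pos:
  fixes T :: "'a::{real_inner, complete_space} \<Rightarrow> 'a"
  assumes T: "nuclear T" "self_adjoint T" "nonneg_operator T" and nz: "T \<noteq> (\<lambda>x. 0)"
  shows "operator_trace T > 0"
proof -
  define B :: "'a set" where "B = (SOME B. orthonormal_basis B)"
  have "orthonormal_basis B" unfolding B_def using exists_orthonormal_basis by (rule someI_ex)
  then have B: "orthonormal_set B" "closure (span B) = UNIV"
    by (auto simp: orthonormal_basis_def orthonormal_set_def)
  have bl: "bounded_linear T" using T(1) by (simp add: nuclear_def)
  have nn: "inner (T e) e \<ge> 0" for e using T(3) by (simp add: nonneg_operator_def)
  obtain C where C: "\<And>F. orthonormal_set F \<Longrightarrow> finite F \<Longrightarrow> (\<Sum>e\<in>F. inner (T e) e) \<le> C"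
    using nuclear_orthonormal_sum_bounded[OF T(1)] by metis
  have sum: "(\<lambda>e. inner (T e) e) summable_on B"
    using B(1) nn by (intro nonneg_bdd_above_summable_on bdd_aboveI2[where M = C])
      (auto intro!: C intro: orthonormal_set_subset)
  have "\<exists>e\<in>B. T e \<noteq> 0"
  proof (rule ccontr)
    assume "\<not> ?thesis"
    then have "T x = 0" if "x \<in> span B" for x
      using linear_eq_0_on_span[OF bounded_linear.linear[OF bl]] that by blast
    moreover have "closed {x. T x = 0}"
      using bl by (intro closed_Collect_eq) (auto intro: bounded_linear.continuous_on continuous_on_id)
    ultimately have "closure (span B) \<subseteq> {x. T x = 0}" by (intro closure_minimal) auto
    then show False using nz B(2) by auto
  qed
  then obtain e where e: "e \<in> B" "T e \<noteq> 0" by blast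
  then have "inner (T e) e \<noteq> 0" using nonneg_operator_form_zeroD[OF bl T(2,3)] by blast
  then have "0 < (\<Sum>d\<in>{e}. inner (T d) d)" using nn[of e] by simp
  also have "\<dots> \<le> (\<Sum>\<^sub>\<infinity>d\<in>B. inner (T d) d)" using sum e nn by (intro finite_sum_le_infsum) auto
  finally show ?thesis by (simp add: operator_trace_def B_def)
qed

text \<open>
  Nuclear operators are compact. The coordinate sequences \<open>\<langle>u\<^sub>j, x\<^sub>k\<rangle>\<close> lie in a product of compact
  intervals, so a subsequence converges in every coordinate \<open>j\<close>; since they are dominated by the summable
  \<open>\<parallel>u\<^sub>j\<parallel> \<parallel>v\<^sub>j\<parallel>\<close>, the images form a Cauchy sequence by Tannery's theorem. The theorem is applied to the real
  series that bounds the distance between two images, over pairs of positions.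
\<close>
lemma nuclear_seq_compact:
  fixes T :: "'a::{real_inner, complete_space} \<Rightarrow> 'a"
  assumes T: "nuclear T" and x: "\<And>k. norm (x k) \<le> 1"
  obtains r y where "strict_mono (r :: nat \<Rightarrow> nat)" "(\<lambda>k. T (x (r k))) \<longlonglongrightarrow> y"
proof -
  from T obtain u v :: "nat \<Rightarrow> 'a" where uv: "summable (\<lambda>j. norm (u j) * norm (v j))"
    and T: "\<And>x. (\<lambda>j. inner (u j) x *\<^sub>R v j) sums T x" and bl: "bounded_linear T"
    unfolding nuclear_def by blast
  define K where "K = (\<Pi>\<^sub>E j\<in>UNIV. cball (0::real) (norm (u j)))"
  have "compact K"
    using compactin_PiE[of "\<lambda>_. euclidean :: real topology" "UNIV :: nat set" "\<lambda>j. cball (0::real) (norm (u j))"]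
    unfolding K_def by (simp add: euclidean_product_topology)
  then have "seq_compact K" by (simp add: compact_eq_seq_compact_metric)
  have bound: "\<bar>inner (u j) (x k)\<bar> \<le> norm (u j)" for j k
  proof -
    have "\<bar>inner (u j) (x k)\<bar> \<le> norm (u j) * norm (x k)" by (rule Cauchy_Schwarz_ineq2)
    also have "\<dots> \<le> norm (u j) * 1" using x by (intro mult_left_mono) auto
    finally show ?thesis by simp
  qed
  then have inK: "(\<lambda>j. inner (u j) (x k)) \<in> K" for k by (auto simp: K_def)
  obtain c r where r: "strict_mono (r :: nat \<Rightarrow> nat)" and c: "((\<lambda>k j. inner (u j) (x k)) \<circ> r) \<longlonglongrightarrow> c"
    using seq_compactE[OF \<open>seq_compact K\<close>, of "\<lambda>k j. inner (u j) (x k)"] inK by metis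
  have coord: "(\<lambda>k. inner (u j) (x (r k))) \<longlonglongrightarrow> c j" for j
    using continuous_on_tendsto_compose[OF continuous_on_product_coordinates[of j] c] by (simp add: o_def)
  let ?F = "sequentially \<times>\<^sub>F sequentially"
  \<comment> \<open>The index \<open>p\<close> is a pair of positions in the subsequence; the limit is taken along both.\<close>
  define a where "a j p = \<bar>inner (u j) (x (r (fst p))) - inner (u j) (x (r (snd p)))\<bar> * norm (v j)" for j p
  have nt: "?F \<noteq> bot" by (simp add: prod_filter_eq_bot)
  have lim_a: "(a j \<longlongrightarrow> 0) ?F" for j
  proof -
    have "(a j \<longlongrightarrow> \<bar>c j - c j\<bar> * norm (v j)) ?F"
      unfolding a_def by (intro tendsto_intros filterlim_compose[OF coord] filterlim_fst filterlim_snd)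
    then show ?thesis by simp
  qed
  have bound_a: "norm (a j p) \<le> 2 * (norm (u j) * norm (v j))" for j p
  proof -
    have "\<bar>inner (u j) (x (r (fst p))) - inner (u j) (x (r (snd p)))\<bar> \<le> 2 * norm (u j)"
      using bound[of j "r (fst p)"] bound[of j "r (snd p)"] by linarith
    then have "a j p \<le> 2 * norm (u j) * norm (v j)"
      unfolding a_def by (rule mult_right_mono) simp
    then show ?thesis by (simp add: a_def)
  qed
  have "\<forall>\<^sub>F (j, p) in sequentially \<times>\<^sub>F ?F. norm (a j p) \<le> 2 * (norm (u j) * norm (v j))"
    using bound_a by (intro always_eventually) auto
  then have tannery: "((\<lambda>p. \<Sum>j. a j p) \<longlongrightarrow> (\<Sum>j. 0)) ?F"
    using tannerys_theorem[where a = a and b = "\<lambda>_. 0", OF lim_a _ summable_mult[OF uv, of 2] nt] by blast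
  have sum_a: "summable (\<lambda>j. a j p)" for p
    by (rule summable_comparison_test'[OF summable_mult[OF uv, of 2], where N = 0]) (rule bound_a)
  have dist_le: "norm (T (x (r k)) - T (x (r l))) \<le> (\<Sum>j. a j (k, l))" for k l
  proof -
    have "(\<lambda>j. inner (u j) (x (r k) - x (r l)) *\<^sub>R v j) sums (T (x (r k)) - T (x (r l)))"
      using T[of "x (r k) - x (r l)"] bounded_linear.linear[OF bl] by (simp add: linear_diff)
    then have "(\<lambda>n. norm (\<Sum>j<n. inner (u j) (x (r k) - x (r l)) *\<^sub>R v j)) \<longlonglongrightarrow> norm (T (x (r k)) - T (x (r l)))"
      unfolding sums_def by (rule tendsto_norm)
    moreover have "norm (\<Sum>j<n. inner (u j) (x (r k) - x (r l)) *\<^sub>R v j) \<le> (\<Sum>j. a j (k, l))" for n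
    proof -
      have "norm (\<Sum>j<n. inner (u j) (x (r k) - x (r l)) *\<^sub>R v j) \<le> (\<Sum>j<n. a j (k, l))"
        by (rule order_trans[OF norm_sum]) (simp add: a_def inner_diff_right)
      also have "\<dots> \<le> (\<Sum>j. a j (k, l))" by (intro sum_le_suminf sum_a) (auto simp: a_def)
      finally show ?thesis .
    qed
    ultimately show ?thesis by (intro LIMSEQ_le_const2) auto
  qed
  have "Cauchy (\<lambda>k. T (x (r k)))"
  proof (rule metric_CauchyI)
    fix e :: real assume "e > 0"
    then have "eventually (\<lambda>p. (\<Sum>j. a j p) < e) ?F"
      using order_tendstoD(2)[OF tannery, of e] by simp
    then obtain N where "\<And>k l. k \<ge> N \<Longrightarrow> l \<ge> N \<Longrightarrow> (\<Sum>j. a j (k, l)) < e"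
      unfolding eventually_prod_sequentially by blast
    then show "\<exists>M. \<forall>m\<ge>M. \<forall>n\<ge>M. dist (T (x (r m))) (T (x (r n))) < e"
      unfolding dist_norm using dist_le by (meson le_less_trans)
  qed
  then show ?thesis using that r Cauchy_convergent_iff convergent_def by blast
qed

text \<open>
  For \<open>L = \<parallel>T\<parallel>\<close> and vectors \<open>x\<^sub>k\<close> of norm at most \<open>1\<close> with \<open>\<parallel>T x\<^sub>k\<parallel> \<rightarrow> L\<close>, expanding the square gives
  \<open>\<parallel>T\<^sup>2 x\<^sub>k - L\<^sup>2 x\<^sub>k\<parallel>\<^sup>2 \<le> L\<^sup>2 (L\<^sup>2 - \<parallel>T x\<^sub>k\<parallel>\<^sup>2) \<rightarrow> 0\<close>. By compactness a limit \<open>y\<close> of \<open>T x\<^sub>k\<close> satisfies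
  \<open>T\<^sup>2 y = L\<^sup>2 y\<close>, that is \<open>(T - L)(T + L) y = 0\<close>; and \<open>(T + L) y\<close> is nonzero because \<open>T\<close> is nonnegative.
\<close>
lemma onorm_eigenvector:
  fixes T :: "'a::{real_inner, complete_space} \<Rightarrow> 'a"
  assumes T: "nuclear T" "self_adjoint T" "nonneg_operator T" and nz: "T \<noteq> (\<lambda>x. 0)"
  obtains w where "w \<noteq> 0" "T w = onorm T *\<^sub>R w"
proof -
  have bl: "bounded_linear T" using T(1) by (simp add: nuclear_def)
  interpret T: bounded_linear T by fact
  define L where "L = onorm T"
  have L: "L > 0" using nz onorm_pos_lt[OF bl] by (auto simp: L_def)
  have TL: "norm (T x) \<le> L * norm x" for x using onorm[OF bl] by (simp add: L_def)
  have adj: "inner (T x) y = inner x (T y)" for x y using T(2) by (simp add: self_adjoint_def)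
  have "\<exists>x. norm x \<le> 1 \<and> norm (T x) > L - 1 / real (Suc k)" for k
  proof (rule ccontr)
    assume "\<not> ?thesis"
    then have *: "norm (T x) \<le> L - 1 / real (Suc k)" if "norm x \<le> 1" for x using that by force
    have "L \<le> L - 1 / real (Suc k)"
      unfolding L_def
    proof (rule onorm_bound)
      show "0 \<le> onorm T - 1 / real (Suc k)" using *[of 0] by (simp add: L_def T.zero)
      fix x :: 'a
      show "norm (T x) \<le> (onorm T - 1 / real (Suc k)) * norm x"
      proof (cases "x = 0")
        case False
        then have "norm (T (x /\<^sub>R norm x)) \<le> L - 1 / real (Suc k)" by (intro *) simp
        then show ?thesis using False by (simp add: L_def T.scaleR field_simps)
      qed (simp add: T.zero)
    qed
    then show False by simp
  qed
  then obtain x where x1: "norm (x k) \<le> 1" and xL: "norm (T (x k)) > L - 1 / real (Suc k)" for k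
    by metis
  obtain r y where r: "strict_mono (r :: nat \<Rightarrow> nat)" and y: "(\<lambda>k. T (x (r k))) \<longlonglongrightarrow> y"
    using nuclear_seq_compact[OF T(1), of x] x1 by blast
  have "(\<lambda>k. L - 1 / real (Suc k)) \<longlonglongrightarrow> L"
    using tendsto_diff[OF tendsto_const LIMSEQ_inverse_real_of_nat, of L] by (simp add: inverse_eq_divide)
  moreover have "norm (T (x k)) \<le> L" for k
  proof -
    have "L * norm (x k) \<le> L * 1" using x1 L by (intro mult_left_mono) auto
    then show ?thesis using TL[of "x k"] by simp
  qed
  ultimately have "(\<lambda>k. norm (T (x k))) \<longlonglongrightarrow> L"
    by (intro tendsto_sandwich[of "\<lambda>k. L - 1 / real (Suc k)" "\<lambda>k. norm (T (x k))" sequentially "\<lambda>_. L"]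
        always_eventually allI less_imp_le[OF xL] tendsto_const)
  then have nL: "(\<lambda>k. norm (T (x (r k)))) \<longlonglongrightarrow> L"
    using LIMSEQ_subseq_LIMSEQ[OF _ r] by (auto simp: o_def)
  then have ny: "norm y = L" using tendsto_norm[OF y] LIMSEQ_unique by blast
  have est: "(norm (T (T x) - L\<^sup>2 *\<^sub>R x))\<^sup>2 \<le> L\<^sup>2 * (L\<^sup>2 - (norm (T x))\<^sup>2)" if "norm x \<le> 1" for x
  proof -
    have "(norm (T (T x) - L\<^sup>2 *\<^sub>R x))\<^sup>2 = (norm (T (T x)))\<^sup>2 - 2 * L\<^sup>2 * inner (T (T x)) x + L\<^sup>2 * L\<^sup>2 * (norm x)\<^sup>2"
      unfolding power2_norm_eq_inner
      by (simp add: inner_diff_left inner_diff_right inner_commute algebra_simps)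
    also have "inner (T (T x)) x = (norm (T x))\<^sup>2" by (simp add: adj power2_norm_eq_inner)
    also have "(norm (T (T x)))\<^sup>2 \<le> (L * norm (T x))\<^sup>2" using TL by (intro power_mono) auto
    also have "L\<^sup>2 * L\<^sup>2 * (norm x)\<^sup>2 \<le> L\<^sup>2 * L\<^sup>2 * 1"
      using that by (intro mult_left_mono) (auto simp: power_le_one)
    finally show ?thesis by (simp add: algebra_simps power_mult_distrib)
  qed
  have "(\<lambda>k. L\<^sup>2 * (L\<^sup>2 - (norm (T (x (r k))))\<^sup>2)) \<longlonglongrightarrow> L\<^sup>2 * (L\<^sup>2 - L\<^sup>2)"
    by (intro tendsto_intros nL)
  then have "(\<lambda>k. (norm (T (T (x (r k))) - L\<^sup>2 *\<^sub>R x (r k)))\<^sup>2) \<longlonglongrightarrow> 0"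
    using est[OF x1]
    by (intro tendsto_sandwich[of "\<lambda>_. 0" "\<lambda>k. (norm (T (T (x (r k))) - L\<^sup>2 *\<^sub>R x (r k)))\<^sup>2"
        sequentially "\<lambda>k. L\<^sup>2 * (L\<^sup>2 - (norm (T (x (r k))))\<^sup>2)"] always_eventually allI tendsto_const) simp_all
  then have "(\<lambda>k. sqrt ((norm (T (T (x (r k))) - L\<^sup>2 *\<^sub>R x (r k)))\<^sup>2)) \<longlonglongrightarrow> sqrt 0"
    by (rule tendsto_real_sqrt)
  then have d: "(\<lambda>k. T (T (x (r k))) - L\<^sup>2 *\<^sub>R x (r k)) \<longlonglongrightarrow> 0"
    by (simp add: tendsto_norm_zero_iff)
  have "(\<lambda>k. T (T (x (r k))) - (T (T (x (r k))) - L\<^sup>2 *\<^sub>R x (r k))) \<longlonglongrightarrow> T y - 0"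
    by (intro tendsto_diff d T.tendsto y)
  then have "(\<lambda>k. T (L\<^sup>2 *\<^sub>R x (r k))) \<longlonglongrightarrow> T (T y)"
    by (intro T.tendsto) simp
  moreover have "(\<lambda>k. T (L\<^sup>2 *\<^sub>R x (r k))) \<longlonglongrightarrow> L\<^sup>2 *\<^sub>R y"
    unfolding T.scaleR by (intro tendsto_intros y)
  ultimately have Ty: "T (T y) = L\<^sup>2 *\<^sub>R y" by (rule LIMSEQ_unique)
  define w where "w = T y + L *\<^sub>R y"
  have "T w = L *\<^sub>R w"
    by (simp add: w_def T.add T.scaleR Ty scaleR_add_right power2_eq_square add.commute)
  moreover have "w \<noteq> 0"
  proof
    assume "w = 0"
    then have "inner w y = 0" by simp
    moreover have "inner w y = inner (T y) y + L * (norm y)\<^sup>2"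
      by (simp add: w_def inner_add_left power2_norm_eq_inner)
    moreover have "inner (T y) y \<ge> 0" using T(3) by (simp add: nonneg_operator_def)
    moreover have "L * (norm y)\<^sup>2 > 0" using L ny by simp
    ultimately show False by simp
  qed
  ultimately show ?thesis using that by (simp add: L_def)
qed

lemma orthonormal_set_independent: "orthonormal_set B \<Longrightarrow> independent B"
  unfolding orthonormal_set_def using pairwise_orthogonal_independent[of B] by force

lemma exists_orthonormal_span:
  fixes F :: "'a::real_inner set"
  assumes "finite F"
  obtains G where "finite G" "orthonormal_set G" "span G = span F"
proof -
  obtain C where C: "finite C" "span C = span F" "pairwise orthogonal C"
    using basis_orthogonal[OF assms] by blast
  let ?G = "(\<lambda>x. inverse (norm x) *\<^sub>R x) ` (C - {0})"
  have "span ?G = span (C - {0})" using C by (intro span_image_scale) auto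
  then have "span ?G = span F" using C(2) by (simp add: span_delete_0)
  moreover have "orthonormal_set ?G"
    unfolding orthonormal_set_def
  proof (intro conjI ballI pairwiseI)
    fix x y assume "x \<in> ?G" "y \<in> ?G" "x \<noteq> y"
    then obtain x' y' where xy: "x' \<in> C" "y' \<in> C" "x' \<noteq> y'"
      "x = inverse (norm x') *\<^sub>R x'" "y = inverse (norm y') *\<^sub>R y'" by blast
    then show "orthogonal x y" using pairwiseD[OF C(3) xy(1-3)] by (simp add: orthogonal_clauses)
  next
    fix e assume "e \<in> ?G"
    then obtain x where "x \<noteq> 0" "e = inverse (norm x) *\<^sub>R x" by blast
    then show "norm e = 1" by simp
  qed
  ultimately show ?thesis using that[of ?G] C(1) by simp
qed

text \<open>
  The eigenspace contributes \<open>L\<close> per dimension to the sums bounded in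
  \<open>nuclear_orthonormal_sum_bounded\<close>, hence is finite-dimensional. Finiteness matters because \<open>dim\<close> of an
  infinite-dimensional space is \<open>0\<close>.
\<close>
lemma eigenspace_orthonormal_basis:
  fixes T :: "'a::real_inner \<Rightarrow> 'a"
  assumes T: "nuclear T" and L: "L > 0"
  obtains B where "finite B" "orthonormal_set B" "card B = dim {x. L *\<^sub>R x - T x = 0}"
    "span B = {x. L *\<^sub>R x - T x = 0}"
proof -
  let ?E = "{x. L *\<^sub>R x - T x = 0}"
  have bl: "bounded_linear T" using T by (simp add: nuclear_def)
  interpret T: bounded_linear T by fact
  have E: "subspace ?E"
    by (rule subspaceI)
      (simp_all add: T.zero T.add T.scaleR scaleR_add_right scaleR_left_commute del: scaleR_scaleR)
  obtain C where C: "\<And>F. orthonormal_set F \<Longrightarrow> finite F \<Longrightarrow> (\<Sum>e\<in>F. inner (T e) e) \<le> C"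
    using nuclear_orthonormal_sum_bounded[OF T] by metis
  obtain D where D: "D \<subseteq> ?E" "independent D" "?E \<subseteq> span D" "card D = dim ?E"
    using basis_exists[of ?E] .
  have "card G \<le> nat \<lfloor>C / L\<rfloor>" if G: "G \<subseteq> D" "finite G" for G
  proof -
    obtain H where H: "finite H" "orthonormal_set H" "span H = span G"
      using exists_orthonormal_span[OF G(2)] .
    have "H \<subseteq> ?E" using H(3) G(1) D(1) span_superset[of H] span_minimal[OF _ E, of G] by blast
    have "inner (T e) e = L" if "e \<in> H" for e
    proof -
      have "T e = L *\<^sub>R e" using \<open>H \<subseteq> ?E\<close> that by auto
      then show ?thesis using H(2) that by (simp add: orthonormal_set_inner)
    qed
    then have "real (card H) * L \<le> C" using C[OF H(2,1)] by simp
    then have "real (card H) \<le> C / L" by (simp only: pos_le_divide_eq[OF L])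
    moreover have "card H = card G"
      using dim_span_eq_card_independent[OF orthonormal_set_independent[OF H(2)]]
        dim_span_eq_card_independent[OF independent_mono[OF D(2) G(1)]] H(3) by (simp only:)
    ultimately show ?thesis by (intro le_nat_floor) (simp only:)
  qed
  then have "finite D" using finite_if_finite_subsets_card_bdd by blast
  then obtain B where B: "finite B" "orthonormal_set B" "span B = span D"
    using exists_orthonormal_span by blast
  have "span D = ?E" using D(1,3) span_minimal[OF _ E] by blast
  then have "span B = ?E" using B(3) by (simp only:)
  have "card B = card D"
    using dim_span_eq_card_independent[OF orthonormal_set_independent[OF B(2)]]
      dim_span_eq_card_independent[OF D(2)] B(3) by (simp only:)
  then have "card B = dim ?E" using D(4) by (simp only:)
  then show ?thesis using \<open>span B = ?E\<close> by (rule that[OF B(1,2)])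
qed

section \<open>The operator on the orthogonal complement\<close>

lemma orth_proj_commutes_invariant:
  fixes U :: "'a::{real_inner, complete_space} set"
  assumes U: "subspace U" "closed U" and Q: "linear Q"
    and inv: "invariant_under Q U" "invariant_under Q (orthogonal_comp U)"
  shows "orth_proj U (Q x) = Q (orth_proj U x)"
proof (rule orth_proj_eqI[OF U(1)])
  show "Q (orth_proj U x) \<in> U"
    using inv(1) orth_proj_in[OF U] unfolding invariant_under_def by blast
  have "Q (x - orth_proj U x) \<in> orthogonal_comp U"
    using inv(2) orth_proj_compl[OF U] unfolding invariant_under_def by blast
  then show "Q x - Q (orth_proj U x) \<in> orthogonal_comp U"
    by (simp add: linear_diff[OF Q])
qed

text \<open>
  Composing with a projection replaces each \<open>u\<^sub>k\<close> in the nuclear representation by its component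
  orthogonal to \<open>U\<close>, which is not longer.
\<close>
lemma nuclear_compl_operator:
  fixes U :: "'a::{real_inner, complete_space} set"
  assumes U: "subspace U" "closed U" and Q: "nuclear Q"
  shows "nuclear (\<lambda>x. Q (x - orth_proj U x))"
proof -
  from Q obtain u v :: "nat \<Rightarrow> 'a" where uv: "summable (\<lambda>k. norm (u k) * norm (v k))"
    and Qs: "\<And>x. (\<lambda>k. inner (u k) x *\<^sub>R v k) sums Q x" and bl: "bounded_linear Q"
    unfolding nuclear_def by blast
  let ?u = "\<lambda>k. u k - orth_proj U (u k)"
  have "bounded_linear (\<lambda>x. Q (x - orth_proj U x))"
    by (intro bounded_linear_compose[OF bl] bounded_linear_sub bounded_linear_ident bounded_linear_orth_proj U)
  moreover have "summable (\<lambda>k. norm (?u k) * norm (v k))"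
    by (rule summable_comparison_test'[OF uv, where N = 0])
      (auto intro!: mult_right_mono norm_compl_orth_proj_le[OF U])
  moreover have "inner (u k) (x - orth_proj U x) = inner (?u k) x" for k x
    by (simp add: inner_diff_left inner_diff_right inner_orth_proj_swap[OF U])
  then have "(\<lambda>k. inner (?u k) x *\<^sub>R v k) sums Q (x - orth_proj U x)" for x
    using Qs[of "x - orth_proj U x"] by simp
  ultimately show ?thesis
    unfolding nuclear_def by (intro conjI exI[of _ ?u] exI[of _ v] allI)
qed

lemma compl_operator_self_adjoint_nonneg:
  fixes U :: "'a::{real_inner, complete_space} set"
  assumes U: "subspace U" "closed U" and Q: "linear Q" "self_adjoint Q" "nonneg_operator Q"
    and inv: "invariant_under Q U" "invariant_under Q (orthogonal_comp U)"
  shows "self_adjoint (\<lambda>x. Q (x - orth_proj U x))" "nonneg_operator (\<lambda>x. Q (x - orth_proj U x))"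
proof -
  have adj: "inner (Q x) y = inner x (Q y)" for x y using Q(2) by (simp add: self_adjoint_def)
  note comm = orth_proj_commutes_invariant[OF U Q(1) inv]
  show "self_adjoint (\<lambda>x. Q (x - orth_proj U x))"
    unfolding self_adjoint_def
    by (simp add: linear_diff[OF Q(1)] inner_diff_left inner_diff_right adj comm[symmetric] inner_orth_proj_swap[OF U])
  show "nonneg_operator (\<lambda>x. Q (x - orth_proj U x))"
    unfolding nonneg_operator_def
  proof
    fix x
    have "Q (x - orth_proj U x) \<in> orthogonal_comp U"
      using inv(2) orth_proj_compl[OF U] unfolding invariant_under_def by blast
    then have "inner (Q (x - orth_proj U x)) (orth_proj U x) = 0"
      using orth_proj_in[OF U, of x] by (auto simp: orthogonal_comp_def orthogonal_def inner_commute)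
    then have "inner (Q (x - orth_proj U x)) x = inner (Q (x - orth_proj U x)) (x - orth_proj U x)"
      by (simp add: inner_diff_right)
    then show "0 \<le> inner (Q (x - orth_proj U x)) x" using Q(3) by (simp add: nonneg_operator_def)
  qed
qed

section \<open>Independence from characteristic functions\<close>

text \<open>
  A one-dimensional uniqueness theorem for the law of \<open>X\<close> under the probability measure whose density is
  proportional to the weight \<open>W\<close>. Weights built from further random variables carry the information about their
  dependence on \<open>X\<close>, which reduces questions about joint laws to Levy's uniqueness theorem on the real line.
\<close>
lemma (in prob_space) weighted_law_unique:
  assumes [measurable]: "random_variable borel X" "random_variable borel W"
    and W: "\<And>\<omega>. 0 \<le> W \<omega>" "\<And>\<omega>. W \<omega> \<le> K" "expectation W > 0"
    and N: "real_distribution N"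
    and char: "\<And>s. (CLINT \<omega>|M. complex_of_real (W \<omega>) * iexp (s * X \<omega>)) =
      complex_of_real (expectation W) * char N s"
    and A[measurable]: "A \<in> sets borel"
  shows "expectation (\<lambda>\<omega>. W \<omega> * indicator A (X \<omega>)) = expectation W * measure N A"
proof -
  let ?k = "expectation W"
  let ?D = "density M (\<lambda>\<omega>. ennreal (W \<omega> / ?k))"
  have iW: "integrable M W"
    using W by (intro integrable_const_bound[of _ K]) auto
  have nn: "AE \<omega> in M. 0 \<le> W \<omega> / ?k" using W by (intro AE_I2 divide_nonneg_pos) auto
  have "emeasure ?D (space ?D) = (\<integral>\<^sup>+\<omega>. ennreal (W \<omega> / ?k) \<partial>M)"
    by (subst emeasure_density) (auto intro!: nn_integral_cong)
  also have "\<dots> = ennreal (\<integral>\<omega>. W \<omega> / ?k \<partial>M)"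
    using iW nn by (intro nn_integral_eq_integral) auto
  also have "\<dots> = 1" using W(3) by simp
  finally interpret D: prob_space ?D by (rule prob_spaceI)
  have "char (distr ?D borel X) = char N"
  proof
    fix s
    have "char (distr ?D borel X) s = (CLINT \<omega>|?D. iexp (s * X \<omega>))"
      unfolding char_def by (subst integral_distr) auto
    also have "\<dots> = (CLINT \<omega>|M. (W \<omega> / ?k) *\<^sub>R iexp (s * X \<omega>))"
      using nn by (subst integral_density) auto
    also have "\<dots> = (CLINT \<omega>|M. complex_of_real (1 / ?k) * (complex_of_real (W \<omega>) * iexp (s * X \<omega>)))"
      by (intro Bochner_Integration.integral_cong refl) (simp add: scaleR_conv_of_real)
    also have "\<dots> = complex_of_real (1 / ?k) * (complex_of_real ?k * char N s)"
      unfolding char[symmetric] by (rule integral_mult_right_zero)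
    also have "\<dots> = char N s" using W(3) by simp
    finally show "char (distr ?D borel X) s = char N s" .
  qed
  moreover have "real_distribution (distr ?D borel X)"
    by (rule D.real_distribution_distr) simp
  ultimately have eq: "distr ?D borel X = N" using N by (intro Levy_uniqueness)
  have "measure N A = (\<integral>x. indicator A x \<partial>distr ?D borel X)" unfolding eq[symmetric] by simp
  also have "\<dots> = (\<integral>\<omega>. indicator A (X \<omega>) \<partial>?D)" by (subst integral_distr) auto
  also have "\<dots> = (\<integral>\<omega>. (W \<omega> / ?k) *\<^sub>R indicator A (X \<omega>) \<partial>M)" using nn by (subst integral_density) auto
  also have "\<dots> = (\<integral>\<omega>. (1 / ?k) * (W \<omega> * indicator A (X \<omega>)) \<partial>M)"
    by (intro Bochner_Integration.integral_cong refl) simp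
  also have "\<dots> = (1 / ?k) * expectation (\<lambda>\<omega>. W \<omega> * indicator A (X \<omega>))"
    by (rule integral_mult_right_zero)
  finally show ?thesis using W(3) by simp
qed

text \<open>
  If the joint characteristic function of \<open>X\<close> and \<open>Z\<close> factorises, then \<open>exp (\<i> Z)\<close> is uncorrelated with every event
  \<open>X \<in> A\<close>. The positive weights \<open>2 + cos (Z + t)\<close> reduce this to the preceding lemma: under each of
  them \<open>X\<close> keeps its law. The phases \<open>t = 0\<close> and \<open>t = -\<pi>/2\<close> recover the real and imaginary parts. Only
  multiples \<open>-1, 0, 1\<close> of \<open>Z\<close> occur because the cosine is a combination of \<open>exp (\<plusminus> \<i> Z)\<close>.
\<close>
lemma (in prob_space) expectation_indicator_iexp:
  assumes [measurable]: "random_variable borel X" "random_variable borel Z"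
    and N: "real_distribution N"
    and char: "\<And>s e. e \<in> {-1, 0, 1} \<Longrightarrow>
      (CLINT \<omega>|M. iexp (s * X \<omega> + e * Z \<omega>)) = char N s * (CLINT \<omega>|M. iexp (e * Z \<omega>))"
    and A[measurable]: "A \<in> sets borel"
  shows "(CLINT \<omega>|M. indicator A (X \<omega>) *\<^sub>R iexp (Z \<omega>)) = measure N A *\<^sub>R (CLINT \<omega>|M. iexp (Z \<omega>))"
    and "prob (X -` A \<inter> space M) = measure N A"
proof -
  have int_iexp: "integrable M (\<lambda>\<omega>. iexp (f \<omega>))" if "random_variable borel f" for f :: "'a \<Rightarrow> real"
    using that by (intro integrable_iexp) auto
  have ind: "expectation (\<lambda>\<omega>. 1 * indicator A (X \<omega>)) = expectation (\<lambda>\<omega>. 1) * measure N A"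
    using char[of 0] prob_space
    by (intro weighted_law_unique[where K = 1] N) auto
  then show pA: "prob (X -` A \<inter> space M) = measure N A"
    by (simp add: prob_space indicator_vimage[symmetric] del: indicator_vimage)
  have cos_case: "expectation (\<lambda>\<omega>. indicator A (X \<omega>) * cos (Z \<omega> + t)) = measure N A * expectation (\<lambda>\<omega>. cos (Z \<omega> + t))"
    for t :: real
  proof -
    let ?W = "\<lambda>\<omega>. 2 + cos (Z \<omega> + t)"
    have i1: "integrable M (\<lambda>\<omega>. cos (Z \<omega> + t))"
      by (intro integrable_const_bound[of _ 1]) auto
    have EW: "expectation ?W = 2 + expectation (\<lambda>\<omega>. cos (Z \<omega> + t))"
      using i1 prob_space by simp
    have lb: "1 \<le> ?W \<omega>" for \<omega> using cos_ge_minus_one[of "Z \<omega> + t"] by linarith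
    have ub: "?W \<omega> \<le> 3" for \<omega> using cos_le_one[of "Z \<omega> + t"] by linarith
    have "expectation (\<lambda>_. 1) \<le> expectation ?W" using i1 lb by (intro integral_mono) auto
    then have pos: "expectation ?W > 0" using prob_space by simp
    have cosE: "complex_of_real (cos (y + t)) = (cis t / 2) * iexp (1 * y) + (cis (- t) / 2) * iexp (- 1 * y)" for y
      by (simp add: cos_of_real[symmetric] cos_exp_eq cis_conv_exp exp_add[symmetric] field_simps)
    have E1: "complex_of_real (expectation (\<lambda>\<omega>. cos (Z \<omega> + t))) =
      (cis t / 2) * (CLINT \<omega>|M. iexp (1 * Z \<omega>)) + (cis (- t) / 2) * (CLINT \<omega>|M. iexp (- 1 * Z \<omega>))"
      unfolding integral_complex_of_real[symmetric] cosE
      by (subst Bochner_Integration.integral_add, (intro integrable_mult_right int_iexp; measurable),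
            (intro integrable_mult_right int_iexp; measurable)) (simp only: integral_mult_right_zero)
    have E2: "(CLINT \<omega>|M. complex_of_real (?W \<omega>) * iexp (s * X \<omega>)) = complex_of_real (expectation ?W) * char N s" for s
    proof -
      have c0: "(CLINT \<omega>|M. iexp (s * X \<omega> + 0 * Z \<omega>)) = char N s * (CLINT \<omega>|M. iexp (0 * Z \<omega>))"
        by (rule char) simp
      have c1: "(CLINT \<omega>|M. iexp (s * X \<omega> + 1 * Z \<omega>)) = char N s * (CLINT \<omega>|M. iexp (1 * Z \<omega>))"
        by (rule char) simp
      have c2: "(CLINT \<omega>|M. iexp (s * X \<omega> + - 1 * Z \<omega>)) = char N s * (CLINT \<omega>|M. iexp (- 1 * Z \<omega>))"
        by (rule char) simp
      have "(CLINT \<omega>|M. complex_of_real (?W \<omega>) * iexp (s * X \<omega>)) =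
        (CLINT \<omega>|M. 2 * iexp (s * X \<omega> + 0 * Z \<omega>) + ((cis t / 2) * iexp (s * X \<omega> + 1 * Z \<omega>)
           + (cis (- t) / 2) * iexp (s * X \<omega> + - 1 * Z \<omega>)))"
        by (intro Bochner_Integration.integral_cong refl)
          (simp only: of_real_add cosE, simp add: exp_add[symmetric] field_simps exp_diff)
      also have "\<dots> = 2 * (CLINT \<omega>|M. iexp (s * X \<omega> + 0 * Z \<omega>)) + ((cis t / 2) * (CLINT \<omega>|M. iexp (s * X \<omega> + 1 * Z \<omega>))
           + (cis (- t) / 2) * (CLINT \<omega>|M. iexp (s * X \<omega> + - 1 * Z \<omega>)))"
        by (subst Bochner_Integration.integral_add,
            (intro integrable_mult_right int_iexp Bochner_Integration.integrable_add; measurable),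
            (intro integrable_mult_right int_iexp Bochner_Integration.integrable_add; measurable),
            subst Bochner_Integration.integral_add,
            (intro integrable_mult_right int_iexp Bochner_Integration.integrable_add; measurable),
            (intro integrable_mult_right int_iexp Bochner_Integration.integrable_add; measurable))
          (simp only: integral_mult_right_zero)
      also have "\<dots> = complex_of_real (expectation ?W) * char N s"
        unfolding c0 c1 c2 EW unfolding of_real_add E1 using prob_space by (simp add: algebra_simps)
      finally show ?thesis .
    qed
    have "expectation (\<lambda>\<omega>. ?W \<omega> * indicator A (X \<omega>)) = expectation ?W * measure N A"
      using lb order_trans[OF zero_le_one lb] by (intro weighted_law_unique[where K = 3] pos N E2 ub) auto
    moreover have "expectation (\<lambda>\<omega>. ?W \<omega> * indicator A (X \<omega>)) =
        expectation (\<lambda>\<omega>. 2 * (1 * indicator A (X \<omega>)) + indicator A (X \<omega>) * cos (Z \<omega> + t))"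
      by (intro Bochner_Integration.integral_cong refl) (simp add: algebra_simps)
    moreover have "\<dots> = 2 * expectation (\<lambda>\<omega>. 1 * indicator A (X \<omega>)) + expectation (\<lambda>\<omega>. indicator A (X \<omega>) * cos (Z \<omega> + t))"
    proof (subst Bochner_Integration.integral_add)
      show "integrable M (\<lambda>\<omega>. 2 * (1 * indicator A (X \<omega>) :: real))"
        by (intro integrable_const_bound[of _ 2]) (auto simp: indicator_def)
      show "integrable M (\<lambda>\<omega>. indicator A (X \<omega>) * cos (Z \<omega> + t))"
        by (intro integrable_const_bound[of _ 1]) (auto simp: indicator_def)
    qed simp
    ultimately show ?thesis unfolding ind EW using prob_space by (simp add: algebra_simps)
  qed
  have iexpE: "iexp y = complex_of_real (cos (y + 0)) + \<i> * complex_of_real (cos (y + - (pi / 2)))" for y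
    by (simp add: cis_conv_exp[symmetric] complex_eq_iff sin_cos_eq[symmetric] cos_diff)
  have split: "(CLINT \<omega>|M. g \<omega> *\<^sub>R iexp (Z \<omega>)) = complex_of_real (expectation (\<lambda>\<omega>. g \<omega> * cos (Z \<omega> + 0)))
      + \<i> * complex_of_real (expectation (\<lambda>\<omega>. g \<omega> * cos (Z \<omega> + - (pi / 2))))"
    if [measurable]: "random_variable borel g" and g: "\<And>\<omega>. \<bar>g \<omega>\<bar> \<le> 1" for g :: "'a \<Rightarrow> real"
  proof -
    have i: "integrable M (\<lambda>\<omega>. g \<omega> * cos (Z \<omega> + t))" for t
      using g by (intro integrable_const_bound[of _ 1]) (auto simp: abs_mult intro!: mult_le_one)
    have "(CLINT \<omega>|M. g \<omega> *\<^sub>R iexp (Z \<omega>)) = (CLINT \<omega>|M. complex_of_real (g \<omega> * cos (Z \<omega> + 0))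
      + \<i> * complex_of_real (g \<omega> * cos (Z \<omega> + - (pi / 2))))"
      unfolding iexpE by (intro Bochner_Integration.integral_cong refl)
        (simp add: scaleR_conv_of_real algebra_simps)
    also have "\<dots> = (CLINT \<omega>|M. complex_of_real (g \<omega> * cos (Z \<omega> + 0)))
      + (CLINT \<omega>|M. \<i> * complex_of_real (g \<omega> * cos (Z \<omega> + - (pi / 2))))"
      by (intro Bochner_Integration.integral_add integrable_mult_right integrable_of_real i)
    finally show ?thesis by (simp only: integral_complex_of_real integral_mult_right_zero)
  qed
  have ind_meas: "random_variable borel (\<lambda>\<omega>. indicator A (X \<omega>) :: real)" by measurable
  have "(CLINT \<omega>|M. indicator A (X \<omega>) *\<^sub>R iexp (Z \<omega>)) =
      measure N A *\<^sub>R (complex_of_real (expectation (\<lambda>\<omega>. 1 * cos (Z \<omega> + 0)))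
        + \<i> * complex_of_real (expectation (\<lambda>\<omega>. 1 * cos (Z \<omega> + - (pi / 2)))))"
    unfolding split[OF ind_meas indicator_abs_le_1] cos_case by (simp add: scaleR_conv_of_real algebra_simps)
  also have "complex_of_real (expectation (\<lambda>\<omega>. 1 * cos (Z \<omega> + 0)))
        + \<i> * complex_of_real (expectation (\<lambda>\<omega>. 1 * cos (Z \<omega> + - (pi / 2)))) = (CLINT \<omega>|M. iexp (Z \<omega>))"
    by (subst split[symmetric]) auto
  finally show "(CLINT \<omega>|M. indicator A (X \<omega>) *\<^sub>R iexp (Z \<omega>)) = measure N A *\<^sub>R (CLINT \<omega>|M. iexp (Z \<omega>))" .
qed

text \<open>
  Induction on the number of variables, for all probability measures at once: conditioning on the event
  \<open>X\<^sub>j \<in> A\<^sub>j\<close> leaves the characteristic function of the remaining variables unchanged, so the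
  induction hypothesis applies to the conditional measure.
\<close>
lemma prob_box_of_char:
  fixes X :: "'i \<Rightarrow> 'b \<Rightarrow> real"
  assumes "finite I" and "\<And>i. i \<in> I \<Longrightarrow> real_distribution (N i)"
    and "\<And>i. i \<in> I \<Longrightarrow> A i \<in> sets borel"
    and "prob_space M"
    and "\<And>i. i \<in> I \<Longrightarrow> X i \<in> borel_measurable M"
    and "\<And>a. (CLINT \<omega>|M. iexp (\<Sum>i\<in>I. a i * X i \<omega>)) = (\<Prod>i\<in>I. char (N i) (a i))"
  shows "measure M {\<omega> \<in> space M. \<forall>i\<in>I. X i \<omega> \<in> A i} = (\<Prod>i\<in>I. measure (N i) (A i))"
  using assms
proof (induction I arbitrary: M rule: finite_induct)
  case empty
  then show ?case by (simp add: prob_space.prob_space)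
next
  case (insert j I M)
  interpret prob_space M by fact
  have [measurable]: "random_variable borel (X j)" using insert.prems(4) by simp
  have XI[measurable]: "random_variable borel (X i)" if "i \<in> I" for i using insert.prems(4) that by simp
  have Aj[measurable]: "A j \<in> sets borel" using insert.prems(2) by simp
  have AI[measurable]: "A i \<in> sets borel" if "i \<in> I" for i using insert.prems(2) that by simp
  have Nj: "real_distribution (N j)" using insert.prems(1) by simp
  interpret Nj: real_distribution "N j" by fact
  define Z where "Z a \<omega> = (\<Sum>i\<in>I. a i * X i \<omega>)" for a :: "'i \<Rightarrow> real" and \<omega>
  have Z[measurable]: "random_variable borel (Z a)" for a unfolding Z_def by measurable
  have joint: "(CLINT \<omega>|M. iexp (s * X j \<omega> + Z a \<omega>)) = char (N j) s * (\<Prod>i\<in>I. char (N i) (a i))" for a s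
  proof -
    have "(\<Sum>i\<in>insert j I. (a(j := s)) i * X i \<omega>) = s * X j \<omega> + Z a \<omega>" for \<omega>
      using insert.hyps by (auto simp: Z_def intro!: sum.cong)
    moreover have "(\<Prod>i\<in>insert j I. char (N i) ((a(j := s)) i)) = char (N j) s * (\<Prod>i\<in>I. char (N i) (a i))"
      using insert.hyps by (auto intro!: prod.cong)
    ultimately show ?thesis using insert.prems(5)[of "a(j := s)"] by simp
  qed
  have EZ: "(CLINT \<omega>|M. iexp (Z a \<omega>)) = (\<Prod>i\<in>I. char (N i) (a i))" for a
    using joint[of 0 a] by (simp add: Nj.char_zero)
  have eZ: "e * Z a \<omega> = Z (\<lambda>i. e * a i) \<omega>" for e a \<omega>
    by (simp add: Z_def sum_distrib_left mult.assoc)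
  have step: "(CLINT \<omega>|M. iexp (s * X j \<omega> + e * Z a \<omega>)) = char (N j) s * (CLINT \<omega>|M. iexp (e * Z a \<omega>))" for s e a
    unfolding eZ joint EZ ..
  note key = expectation_indicator_iexp[OF _ Z Nj step Aj]
  define p where "p = measure (N j) (A j)"
  have p: "prob (X j -` A j \<inter> space M) = p" unfolding p_def by (rule key) simp
  let ?E = "{\<omega> \<in> space M. \<forall>i\<in>I. X i \<omega> \<in> A i}"
  have box: "{\<omega> \<in> space M. \<forall>i\<in>insert j I. X i \<omega> \<in> A i} = (X j -` A j \<inter> space M) \<inter> ?E" by auto
  have E[measurable]: "?E \<in> events" using insert.hyps(1) by (intro sets.sets_Collect_finite_All) auto
  show ?case
  proof (cases "p = 0")
    case True
    have "prob ((X j -` A j \<inter> space M) \<inter> ?E) \<le> prob (X j -` A j \<inter> space M)"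
      by (intro finite_measure_mono) auto
    then show ?thesis unfolding box using True insert.hyps p
      by (simp add: measure_le_0_iff flip: p_def)
  next
    case False
    then have pp: "p > 0" by (simp add: p_def zero_less_measure_iff)
    let ?D = "density M (\<lambda>\<omega>. ennreal (indicator (A j) (X j \<omega>) / p))"
    have nn: "AE \<omega> in M. 0 \<le> indicator (A j) (X j \<omega>) / p" using pp by simp
    have int_ind: "integrable M (\<lambda>\<omega>. indicator B (X j \<omega>) :: real)" if "B \<in> sets borel" for B
      using that by (intro integrable_const_bound[of _ 1]) (auto simp: indicator_def)
    have "expectation (\<lambda>\<omega>. indicator (A j) (X j \<omega>)) = p"
      using p by (simp add: indicator_vimage[symmetric] del: indicator_vimage)
    then have "emeasure ?D (space ?D) = 1"
      using pp nn int_ind[of "A j"] by (subst emeasure_density) (auto simp: nn_integral_eq_integral)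
    then interpret D: prob_space ?D by (rule prob_spaceI)
    have "measure ?D {\<omega> \<in> space ?D. \<forall>i\<in>I. X i \<omega> \<in> A i} = (\<Prod>i\<in>I. measure (N i) (A i))"
    proof (rule insert.IH)
      show "prob_space ?D" by (rule D.prob_space_axioms)
      fix a
      have "(CLINT \<omega>|?D. iexp (\<Sum>i\<in>I. a i * X i \<omega>)) = (CLINT \<omega>|M. (indicator (A j) (X j \<omega>) / p) *\<^sub>R iexp (Z a \<omega>))"
        unfolding Z_def[symmetric] using nn by (subst integral_density) auto
      also have "\<dots> = (CLINT \<omega>|M. (1 / p) *\<^sub>R (indicator (A j) (X j \<omega>) *\<^sub>R iexp (Z a \<omega>)))" by simp
      also have "\<dots> = (1 / p) *\<^sub>R (CLINT \<omega>|M. indicator (A j) (X j \<omega>) *\<^sub>R iexp (Z a \<omega>))"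
        by (rule integral_scaleR_right) 
      also have "\<dots> = (CLINT \<omega>|M. iexp (Z a \<omega>))"
        using pp by (subst key) (auto simp: p_def)
      finally show "(CLINT \<omega>|?D. iexp (\<Sum>i\<in>I. a i * X i \<omega>)) = (\<Prod>i\<in>I. char (N i) (a i))"
        unfolding EZ .
    qed (use insert.prems in auto)
    moreover have "measure ?D {\<omega> \<in> space ?D. \<forall>i\<in>I. X i \<omega> \<in> A i} = (1 / p) * prob ((X j -` A j \<inter> space M) \<inter> ?E)"
    proof -
      have "emeasure ?D ?E = (\<integral>\<^sup>+\<omega>. ennreal (1 / p) * indicator ((X j -` A j \<inter> space M) \<inter> ?E) \<omega> \<partial>M)"
        by (subst emeasure_density) (auto intro!: nn_integral_cong simp: indicator_def)
      also have "\<dots> = ennreal (1 / p) * emeasure M ((X j -` A j \<inter> space M) \<inter> ?E)"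
        by (subst nn_integral_cmult_indicator) auto
      also have "\<dots> = ennreal ((1 / p) * prob ((X j -` A j \<inter> space M) \<inter> ?E))"
        using pp by (simp only: emeasure_eq_measure) (rule ennreal_mult'[symmetric], simp)
      finally show ?thesis using pp by (simp add: measure_def)
    qed
    ultimately show ?thesis unfolding box using pp insert.hyps by (simp add: p_def field_simps)
  qed
qed

lemma distr_PiM_of_char:
  fixes X :: "'i \<Rightarrow> 'b \<Rightarrow> real"
  assumes I: "finite I" and N: "\<And>i. real_distribution (N i)"
    and M: "prob_space M" and X[measurable]: "\<And>i. i \<in> I \<Longrightarrow> X i \<in> borel_measurable M"
    and char: "\<And>a. (CLINT \<omega>|M. iexp (\<Sum>i\<in>I. a i * X i \<omega>)) = (\<Prod>i\<in>I. char (N i) (a i))"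
  shows "distr M (Pi\<^sub>M I (\<lambda>_. borel)) (\<lambda>\<omega>. \<lambda>i\<in>I. X i \<omega>) = Pi\<^sub>M I N"
proof -
  interpret prob_space M by fact
  interpret N: product_sigma_finite N
    using N by (intro product_sigma_finite.intro prob_space_imp_sigma_finite) (auto simp: real_distribution_def)
  have sN: "sets (N i) = sets borel" for i using N by (simp add: real_distribution.events_eq_borel)
  have pN: "prob_space (N i)" for i using N by (simp add: real_distribution_def)
  show ?thesis
  proof (rule N.PiM_eqI[OF I])
    show "sets (distr M (Pi\<^sub>M I (\<lambda>_. borel)) (\<lambda>\<omega>. \<lambda>i\<in>I. X i \<omega>)) = sets (Pi\<^sub>M I N)"
      by (simp add: sN cong: sets_PiM_cong)
    fix A assume "\<And>i. i \<in> I \<Longrightarrow> A i \<in> sets (N i)"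
    then have A: "\<And>i. i \<in> I \<Longrightarrow> A i \<in> sets borel" by (simp add: sN)
    have "emeasure (distr M (Pi\<^sub>M I (\<lambda>_. borel)) (\<lambda>\<omega>. \<lambda>i\<in>I. X i \<omega>)) (Pi\<^sub>E I A) =
        emeasure M {\<omega> \<in> space M. \<forall>i\<in>I. X i \<omega> \<in> A i}"
      using A I by (subst emeasure_distr) (auto intro!: arg_cong[where f = "emeasure M"] sets_PiM_I_finite)
    also have "\<dots> = ennreal (\<Prod>i\<in>I. measure (N i) (A i))"
      unfolding emeasure_eq_measure
      using prob_box_of_char[OF I N A M X char] by simp
    also have "\<dots> = (\<Prod>i\<in>I. emeasure (N i) (A i))"
      using pN by (simp add: prod_ennreal[symmetric] finite_measure.emeasure_eq_measure prob_space_def)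
    finally show "emeasure (distr M (Pi\<^sub>M I (\<lambda>_. borel)) (\<lambda>\<omega>. \<lambda>i\<in>I. X i \<omega>)) (Pi\<^sub>E I A) =
      (\<Prod>i\<in>I. emeasure (N i) (A i))" .
  qed
qed

lemma normal_law_iexp:
  assumes "v \<ge> 0"
  shows "(CLINT x|normal_law m v. iexp (x - m)) = exp (- complex_of_real v / 2)"
proof (cases "v = 0")
  case True
  then show ?thesis by (simp add: normal_law_def integral_return)
next
  case False
  with assms have v: "sqrt v > 0" by simp
  let ?D = "density lborel (\<lambda>x. ennreal (normal_density m (sqrt v) x))"
  interpret D: prob_space ?D using v by (rule prob_space_normal_density)
  have "distributed ?D lborel (\<lambda>x. x) (\<lambda>x. ennreal (normal_density m (sqrt v) x))"
    by (auto simp: distributed_def distr_id2[unfolded id_def])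
  then have "distributed ?D lborel (\<lambda>x. (x - m) / sqrt v) (\<lambda>x. ennreal (std_normal_density x))"
    using D.normal_standard_normal_convert[OF v, of "\<lambda>x. x" m] by simp
  then have std: "distr ?D borel (\<lambda>x. (x - m) / sqrt v) = std_normal_distribution"
    unfolding distributed_def by (metis distr_cong sets_lborel)
  have "(CLINT x|?D. iexp (x - m)) = (CLINT x|?D. iexp (sqrt v * ((x - m) / sqrt v)))"
    using v by simp
  also have "\<dots> = char (distr ?D borel (\<lambda>x. (x - m) / sqrt v)) (sqrt v)"
    unfolding char_def by (subst integral_distr) auto
  also have "\<dots> = exp (- complex_of_real v / 2)"
    unfolding std char_std_normal_distribution using assms by (simp add: exp_of_real[symmetric])
  finally show ?thesis using False by (simp add: normal_law_def)
qed

text \<open>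
  A linear combination of the scores is again the score of a single vector, whose law is prescribed by the
  definition of a Gaussian measure; its variance is the sum of the squared coefficients, so
  the joint characteristic function is a product.
\<close>
lemma gaussian_measure_iid_scores:
  fixes g :: "'i \<Rightarrow> 'a::{real_inner, polish_space}"
  assumes M: "gaussian_measure M \<zeta> C" and C: "linear C"
    and J: "finite J"
    and g: "\<And>i j. i \<in> J \<Longrightarrow> j \<in> J \<Longrightarrow> inner (C (g i)) (g j) = (if i = j then 1 else 0)"
  shows "distr M (Pi\<^sub>M J (\<lambda>_. borel)) (\<lambda>y. \<lambda>i\<in>J. inner (g i) (y - \<zeta>)) = Pi\<^sub>M J (\<lambda>_. std_normal_distribution)"
proof (rule distr_PiM_of_char[OF J])
  show "real_distribution std_normal_distribution" by (rule real_dist_normal_dist)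
  show "prob_space M" using M by (simp add: gaussian_measure_def)
  have sM[measurable_cong]: "sets M = sets borel" using M by (simp add: gaussian_measure_def)
  show "(\<lambda>y. inner (g i) (y - \<zeta>)) \<in> borel_measurable M" for i by measurable
  fix a :: "'i \<Rightarrow> real"
  define h where "h = (\<Sum>i\<in>J. a i *\<^sub>R g i)"
  have "inner (C h) h = (\<Sum>i\<in>J. \<Sum>j\<in>J. a i * (a j * inner (C (g i)) (g j)))"
    unfolding h_def linear_sum[OF C] inner_sum_left
    by (simp add: inner_sum_right linear_cmul[OF C] sum_distrib_left mult.left_commute)
  also have "\<dots> = (\<Sum>i\<in>J. \<Sum>j\<in>J. if i = j then (a i)\<^sup>2 else 0)"
    by (intro sum.cong refl) (auto simp: g power2_eq_square)
  also have "\<dots> = (\<Sum>i\<in>J. (a i)\<^sup>2)" using J by simp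
  finally have v: "inner (C h) h = (\<Sum>i\<in>J. (a i)\<^sup>2)" .
  have "(\<Sum>i\<in>J. a i * inner (g i) (y - \<zeta>)) = inner h y - inner h \<zeta>" for y
    by (simp add: h_def inner_sum_left inner_diff_right sum_subtractf right_diff_distrib)
  then have "(CLINT y|M. iexp (\<Sum>i\<in>J. a i * inner (g i) (y - \<zeta>))) = (CLINT y|M. iexp (inner h y - inner h \<zeta>))"
    by simp
  also have "\<dots> = (CLINT x|distr M borel (\<lambda>y. inner h y). iexp (x - inner h \<zeta>))"
    by (subst integral_distr) auto
  also have "distr M borel (\<lambda>y. inner h y) = normal_law (inner h \<zeta>) (inner (C h) h)"
    using M by (simp add: gaussian_measure_def)
  also have "(CLINT x|\<dots>. iexp (x - inner h \<zeta>)) = exp (- complex_of_real (\<Sum>i\<in>J. (a i)\<^sup>2) / 2)"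
    unfolding v by (rule normal_law_iexp) (simp add: sum_nonneg)
  also have "- complex_of_real (\<Sum>i\<in>J. (a i)\<^sup>2) / 2 = (\<Sum>i\<in>J. - complex_of_real ((a i)\<^sup>2) / 2)"
    by (simp add: sum_negf sum_divide_distrib)
  also have "exp \<dots> = (\<Prod>i\<in>J. exp (- complex_of_real ((a i)\<^sup>2) / 2))" using J by (rule exp_sum)
  also have "\<dots> = (\<Prod>i\<in>J. char std_normal_distribution (a i))"
    by (simp add: char_std_normal_distribution exp_of_real[symmetric])
  finally show "(CLINT y|M. iexp (\<Sum>i\<in>J. a i * inner (g i) (y - \<zeta>))) =
    (\<Prod>i\<in>J. char std_normal_distribution (a i))" .
qed

section \<open>The ratio of a normal variable to the norm of a normal vector\<close>

lemma inverse_sqrt_power: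
  assumes "a > 0"
  shows "inverse (sqrt a) ^ n = a powr (- real n / 2)"
proof -
  have "a powr (- real n / 2) = inverse (a powr (1/2 * real n))"
    by (simp add: powr_minus[symmetric])
  also have "a powr (1/2 * real n) = sqrt a ^ n"
    using assms by (simp only: powr_powr[symmetric] powr_half_sqrt less_imp_le) (simp add: powr_realpow)
  finally show ?thesis by (simp add: power_inverse)
qed

text \<open>
  Polar coordinates: both measures give \<open>{..a}\<close> the volume of a ball of radius \<open>a\<close>. The index set must be nonempty,
  since the norm on the zero-dimensional space has a point mass at \<open>0\<close>.
\<close>
lemma distr_norm_PiM_lborel:
  assumes I: "finite I" "I \<noteq> {}"
  shows "distr (Pi\<^sub>M I (\<lambda>_. lborel)) borel (\<lambda>z. sqrt (\<Sum>i\<in>I. (z i)\<^sup>2)) =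
    density lborel (\<lambda>r. ennreal (real (card I) * unit_ball_vol (real (card I)) * r ^ (card I - 1))
                        * indicator {0..} r)"
    (is "?L = ?R")
proof (rule measure_eqI_generator_eq[where E = "range (\<lambda>a::real. {..a})" and \<Omega> = UNIV
      and A = "\<lambda>i::nat. {..real i}"])
  let ?n = "card I" and ?P = "Pi\<^sub>M I (\<lambda>_. lborel :: real measure)"
  have n: "?n \<ge> 1" using I by (simp add: Suc_leI card_gt_0_iff)
  interpret product_sigma_finite "\<lambda>_. lborel :: real measure" by standard
  have L: "emeasure ?L {..a} = emeasure ?P ({z. sqrt (\<Sum>i\<in>I. (z i)\<^sup>2) \<le> a} \<inter> space ?P)" for a
    by (subst emeasure_distr) (auto intro!: arg_cong[where f = "emeasure ?P"])
  have R: "emeasure ?R {..a} = ennreal (unit_ball_vol (real ?n) * a ^ ?n)" if "a \<ge> 0" for a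
  proof -
    have "emeasure ?R {..a} =
      (\<integral>\<^sup>+r. ennreal (real ?n * unit_ball_vol (real ?n) * r ^ (?n - 1)) * indicator {0..a} r \<partial>lborel)"
      by (subst emeasure_density) (auto intro!: nn_integral_cong simp: indicator_def)
    also have "\<dots> = ennreal (unit_ball_vol (real ?n) * a ^ ?n - unit_ball_vol (real ?n) * 0 ^ ?n)"
      using that n
      by (intro nn_integral_FTC_Icc) (auto intro!: derivative_eq_intros)
    finally show ?thesis using n by (simp add: power_0_left)
  qed
  \<comment> \<open>The ball of radius \<open>0\<close> is a box of null factors, whereas the volume formula requires a positive radius.\<close>
  have zero: "emeasure ?P ({z. sqrt (\<Sum>i\<in>I. (z i)\<^sup>2) \<le> 0} \<inter> space ?P) = 0"
  proof -
    have "{z. sqrt (\<Sum>i\<in>I. (z i)\<^sup>2) \<le> 0} \<inter> space ?P = (\<Pi>\<^sub>E i\<in>I. {0})"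
      using I by (auto simp: space_PiM PiE_def Pi_def sum_nonneg sum_nonneg_eq_0_iff extensional_def
          fun_eq_iff dest!: antisym[OF _ sum_nonneg])
    moreover have "emeasure ?P (\<Pi>\<^sub>E i\<in>I. {0}) = 0"
      using I by (subst emeasure_PiM) (auto simp: prod_zero_iff)
    ultimately show ?thesis by (simp only:)
  qed
  show "emeasure ?L {..real i} \<noteq> \<infinity>" for i
  proof (cases "i = 0")
    case True then show ?thesis using zero by (simp add: L)
  next
    case False then show ?thesis using I by (simp add: L emeasure_cball_aux)
  qed
  fix X :: "real set" assume "X \<in> range (\<lambda>a. {..a})"
  then obtain a where X: "X = {..a}" by auto
  consider "a < 0" | "a = 0" | "a > 0" by linarith
  then show "emeasure ?L X = emeasure ?R X"
  proof cases
    case 1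
    have "{z. sqrt (\<Sum>i\<in>I. (z i)\<^sup>2) \<le> a} = {}"
      using 1 by (auto simp: not_le intro!: less_le_trans[OF 1] real_sqrt_ge_zero sum_nonneg)
    moreover have "emeasure ?R X = 0"
      using 1 unfolding X by (subst emeasure_density) (auto simp: nn_integral_0_iff_AE indicator_def)
    ultimately show ?thesis unfolding X L by simp
  next
    case 2
    then show ?thesis unfolding X using zero R[of 0] n by (simp add: L power_0_left)
  next
    case 3
    then show ?thesis unfolding X using R[of a] I by (simp add: L emeasure_cball_aux)
  qed
next
  show "Int_stable (range (\<lambda>a::real. {..a}))"
    by (auto simp: Int_stable_def)
  show "sets ?L = sigma_sets UNIV (range (\<lambda>a::real. {..a}))"
    by (simp add: borel_eq_atMost)
  show "sets ?R = sigma_sets UNIV (range (\<lambda>a::real. {..a}))"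
    by (simp add: borel_eq_atMost)
  show "(\<Union>i. {..real i}) = UNIV"
    by (auto intro: real_arch_simple)
qed auto

lemma PiM_std_normal:
  assumes I: "finite I"
  shows "Pi\<^sub>M I (\<lambda>_. std_normal_distribution) =
    density (Pi\<^sub>M I (\<lambda>_. lborel)) (\<lambda>z. ennreal ((2 * pi) powr (- real (card I) / 2)
       * exp (- (sqrt (\<Sum>i\<in>I. (z i)\<^sup>2))\<^sup>2 / 2)))" (is "_ = density ?P ?g")
proof -
  interpret lb: product_sigma_finite "\<lambda>_. lborel :: real measure" by standard
  interpret N: product_sigma_finite "\<lambda>_. std_normal_distribution"
    by (intro product_sigma_finite.intro prob_space_imp_sigma_finite prob_space_normal_density) auto
  have g: "?g z = (\<Prod>i\<in>I. ennreal (std_normal_density (z i)))" for z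
  proof -
    have "(\<Prod>i\<in>I. std_normal_density (z i)) = (1 / sqrt (2 * pi)) ^ card I * exp (- (\<Sum>i\<in>I. (z i)\<^sup>2 / 2))"
      unfolding std_normal_density_def using I
      by (simp add: prod_dividef exp_sum sum_negf[symmetric] power_one_over)
    moreover have "(1 / sqrt (2 * pi)) ^ card I = (2 * pi) powr (- real (card I) / 2)"
      using inverse_sqrt_power[of "2 * pi" "card I"] by (simp only: inverse_eq_divide) simp
    ultimately show ?thesis
      using I by (simp add: prod_ennreal sum_nonneg sum_divide_distrib)
  qed
  have "density ?P ?g = Pi\<^sub>M I (\<lambda>_. std_normal_distribution)"
  proof (rule N.PiM_eqI[OF I])
    show "sets (density ?P ?g) = sets (Pi\<^sub>M I (\<lambda>_. std_normal_distribution))"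
      by (simp cong: sets_PiM_cong)
    fix A :: "'a \<Rightarrow> real set" assume A: "\<And>i. i \<in> I \<Longrightarrow> A i \<in> sets std_normal_distribution"
    have "emeasure (density ?P ?g) (Pi\<^sub>E I A) = (\<integral>\<^sup>+z. ?g z * indicator (Pi\<^sub>E I A) z \<partial>?P)"
      using A I by (intro emeasure_density) (auto intro!: sets_PiM_I_finite)
    also have "\<dots> = (\<integral>\<^sup>+z. (\<Prod>i\<in>I. ennreal (std_normal_density (z i)) * indicator (A i) (z i)) \<partial>?P)"
    proof (rule nn_integral_cong)
      fix z assume "z \<in> space ?P"
      then have "indicator (Pi\<^sub>E I A) z = (\<Prod>i\<in>I. indicator (A i) (z i) :: ennreal)"
        using I by (cases "z \<in> Pi\<^sub>E I A") (auto simp: space_PiM PiE_def Pi_def indicator_def)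
      then show "?g z * indicator (Pi\<^sub>E I A) z = (\<Prod>i\<in>I. ennreal (std_normal_density (z i)) * indicator (A i) (z i))"
        unfolding g prod.distrib by simp
    qed
    also have "\<dots> = (\<Prod>i\<in>I. emeasure std_normal_distribution (A i))"
      using A I by (subst lb.product_nn_integral_prod) (auto simp: emeasure_density intro!: prod.cong)
    finally show "emeasure (density ?P ?g) (Pi\<^sub>E I A) = (\<Prod>i\<in>I. emeasure std_normal_distribution (A i))" .
  qed
  then show ?thesis ..
qed

lemma nn_integral_norm_std_normal:
  assumes I: "finite I" "I \<noteq> {}" and f[measurable]: "f \<in> borel_measurable borel"
  shows "(\<integral>\<^sup>+z. f (sqrt (\<Sum>i\<in>I. (z i)\<^sup>2)) \<partial>Pi\<^sub>M I (\<lambda>_. std_normal_distribution)) =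
    (\<integral>\<^sup>+r. f r * (ennreal (real (card I) * unit_ball_vol (real (card I)) * (2 * pi) powr (- real (card I) / 2)
       * (r ^ (card I - 1) * exp (- r\<^sup>2 / 2))) * indicator {0..} r) \<partial>lborel)" (is "_ = ?R")
proof -
  let ?P = "Pi\<^sub>M I (\<lambda>_. lborel :: real measure)" and ?n = "real (card I)"
  let ?h = "\<lambda>r. ennreal ((2 * pi) powr (- ?n / 2) * exp (- r\<^sup>2 / 2)) * f r"
  have "(\<integral>\<^sup>+z. f (sqrt (\<Sum>i\<in>I. (z i)\<^sup>2)) \<partial>Pi\<^sub>M I (\<lambda>_. std_normal_distribution)) =
        (\<integral>\<^sup>+z. ?h (sqrt (\<Sum>i\<in>I. (z i)\<^sup>2)) \<partial>?P)"
    unfolding PiM_std_normal[OF I(1)] by (rule nn_integral_density) auto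
  also have "\<dots> = (\<integral>\<^sup>+r. ?h r \<partial>distr ?P borel (\<lambda>z. sqrt (\<Sum>i\<in>I. (z i)\<^sup>2)))"
    by (subst nn_integral_distr) auto
  also have "\<dots> = ?R"
    unfolding distr_norm_PiM_lborel[OF I]
  proof (subst nn_integral_density, measurable, rule nn_integral_cong)
    fix r :: real
    let ?k = "?n * unit_ball_vol ?n" and ?p = "(2 * pi) powr (- ?n / 2)"
    have "ennreal (?k * r ^ (card I - 1)) * ennreal (?p * exp (- r\<^sup>2 / 2)) =
        ennreal (?k * ?p * (r ^ (card I - 1) * exp (- r\<^sup>2 / 2)))" if "r \<ge> 0"
      using that by (subst ennreal_mult'[symmetric]) (simp_all add: mult_ac)
    note * = this
    show "ennreal (?k * r ^ (card I - 1)) * indicator {0..} r * ?h r =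
        f r * (ennreal (?k * ?p * (r ^ (card I - 1) * exp (- r\<^sup>2 / 2))) * indicator {0..} r)"
    proof (cases "r \<ge> 0")
      case True
      then have "ennreal (?k * r ^ (card I - 1)) * indicator {0..} r * ?h r =
          (ennreal (?k * r ^ (card I - 1)) * ennreal (?p * exp (- r\<^sup>2 / 2))) * f r"
        by (simp only: indicator_simps atLeast_iff mult_1_right mult.assoc)
      then show ?thesis unfolding *[OF True] using True by (simp add: mult.commute)
    qed simp
  qed
  finally show ?thesis .
qed

text \<open>
  The value is forced by the fact that the standard normal law has total mass one in dimension \<open>n\<close>; thus the half-integer
  values of the Gamma function enter only through the volume of the unit ball.
\<close>
lemma nn_integral_radial_std_normal:
  assumes n: "n \<ge> 1"
  shows "(\<integral>\<^sup>+r. ennreal (r ^ (n - 1) * exp (- r\<^sup>2 / 2)) * indicator {0..} r \<partial>lborel) =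
    ennreal ((2 * pi) powr (real n / 2) / (real n * unit_ball_vol (real n)))" (is "?I = ?r")
proof -
  define c where "c = real n * unit_ball_vol (real n) * (2 * pi) powr (- real n / 2)"
  have c: "c > 0" using n by (simp add: c_def)
  have ne: "{..<n} \<noteq> {}" using n by (auto simp: lessThan_empty_iff)
  interpret N: prob_space "Pi\<^sub>M {..<n} (\<lambda>_. std_normal_distribution)"
    by (intro prob_space_PiM prob_space_normal_density) auto
  have "1 = (\<integral>\<^sup>+z. 1 \<partial>Pi\<^sub>M {..<n} (\<lambda>_. std_normal_distribution))"
    by (simp add: N.emeasure_space_1)
  also have "\<dots> = (\<integral>\<^sup>+r. 1 * (ennreal (c * (r ^ (n - 1) * exp (- r\<^sup>2 / 2))) * indicator {0..} r) \<partial>lborel)"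
    using nn_integral_norm_std_normal[OF finite_lessThan ne borel_measurable_const]
    by (simp only: card_lessThan c_def)
  also have "\<dots> = (\<integral>\<^sup>+r. ennreal c * (ennreal (r ^ (n - 1) * exp (- r\<^sup>2 / 2)) * indicator {0..} r) \<partial>lborel)"
    by (simp only: ennreal_mult'[OF less_imp_le[OF c]] mult.assoc mult_1)
  also have "\<dots> = ennreal c * ?I"
    by (rule nn_integral_cmult) auto
  finally have "ennreal (1 / c) * 1 = ennreal (1 / c) * (ennreal c * ?I)" by simp
  also have "\<dots> = ?I"
    using c by (simp add: mult.assoc[symmetric] ennreal_mult'[symmetric])
  finally show ?thesis
    using n by (simp add: c_def powr_minus field_simps)
qed

lemma nn_integral_radial_gaussian:
  assumes n: "n \<ge> 1" and a: "a > 0"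
  shows "(\<integral>\<^sup>+r. ennreal (r ^ (n - 1) * exp (- a * r\<^sup>2 / 2)) * indicator {0..} r \<partial>lborel) =
    ennreal (a powr (- real n / 2) * ((2 * pi) powr (real n / 2) / (real n * unit_ball_vol (real n))))"
proof -
  let ?s = "sqrt a"
  have s: "?s > 0" using a by simp
  have sn: "inverse ?s ^ n = a powr (- real n / 2)"
    using a by (rule inverse_sqrt_power)
  have "(\<integral>\<^sup>+r. ennreal (r ^ (n - 1) * exp (- a * r\<^sup>2 / 2)) * indicator {0..} r \<partial>lborel) =
    ennreal \<bar>inverse ?s\<bar> * (\<integral>\<^sup>+r. ennreal ((0 + inverse ?s * r) ^ (n - 1) * exp (- a * (0 + inverse ?s * r)\<^sup>2 / 2))
       * indicator {0..} (0 + inverse ?s * r) \<partial>lborel)"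
    using s by (intro nn_integral_real_affine) auto
  also have "\<dots> = ennreal \<bar>inverse ?s\<bar> * (\<integral>\<^sup>+r. ennreal (inverse ?s ^ (n - 1)) *
      (ennreal (r ^ (n - 1) * exp (- r\<^sup>2 / 2)) * indicator {0..} r) \<partial>lborel)"
  proof (rule arg_cong2[where f = "(*)", OF refl], rule nn_integral_cong)
    fix r :: real
    have e: "a * (inverse ?s * r)\<^sup>2 = r\<^sup>2"
      using a by (simp add: power_mult_distrib power_inverse)
    show "ennreal ((0 + inverse ?s * r) ^ (n - 1) * exp (- a * (0 + inverse ?s * r)\<^sup>2 / 2))
       * indicator {0..} (0 + inverse ?s * r) = ennreal (inverse ?s ^ (n - 1)) *
      (ennreal (r ^ (n - 1) * exp (- r\<^sup>2 / 2)) * indicator {0..} r)"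
      using s e by (auto simp: indicator_def ennreal_mult'[symmetric] power_mult_distrib zero_le_divide_iff zero_le_mult_iff)
  qed
  also have "\<dots> = ennreal \<bar>inverse ?s\<bar> * (ennreal (inverse ?s ^ (n - 1)) *
      ennreal ((2 * pi) powr (real n / 2) / (real n * unit_ball_vol (real n))))"
    by (subst nn_integral_cmult) (simp_all only: nn_integral_radial_std_normal[OF n], measurable)
  also have "\<dots> = ennreal (inverse ?s * inverse ?s ^ (n - 1) * ((2 * pi) powr (real n / 2) / (real n * unit_ball_vol (real n))))"
    using s by (simp add: ennreal_mult'[symmetric] mult.assoc)
  also have "inverse ?s * inverse ?s ^ (n - 1) = inverse ?s ^ n"
    using n by (simp add: power_eq_if)
  finally show ?thesis unfolding sn .
qed

text \<open>
  Condition on the norm \<open>r\<close> of the denominator, substitute \<open>x = r t / \<surd>n\<close> in the normal density of the numerator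
  and exchange the integrals. The remaining integral over \<open>r\<close> is a radial Gaussian integral in dimension \<open>n + 1\<close>
  with precision \<open>1 + t\<^sup>2/n\<close>, whose power \<open>-(n+1)/2\<close> is the Student density up to the constant.
\<close>
lemma distr_student_ratio:
  assumes I: "finite I" "I \<noteq> {}" and j: "j \<notin> I"
  shows "distr (Pi\<^sub>M (insert j I) (\<lambda>_. std_normal_distribution)) borel
           (\<lambda>z. z j / (sqrt (\<Sum>i\<in>I. (z i)\<^sup>2) / sqrt (real (card I)))) = student_t (card I)"
proof (rule measure_eqI)
  let ?n = "card I" and ?R = "\<lambda>z. sqrt (\<Sum>i\<in>I. (z i)\<^sup>2) :: real"
    and ?N = std_normal_distribution
  let ?PI = "Pi\<^sub>M I (\<lambda>_. ?N)" and ?P = "Pi\<^sub>M (insert j I) (\<lambda>_. ?N)"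
  let ?T = "\<lambda>z. z j / (?R z / sqrt (real ?n))"
  have n: "?n \<ge> 1" using I by (simp add: Suc_leI card_gt_0_iff)
  define m where "m = sqrt (real ?n)"
  have m: "m > 0" "m\<^sup>2 = real ?n" using n by (auto simp: m_def)
  interpret N: product_sigma_finite "\<lambda>_. ?N"
    by (intro product_sigma_finite.intro prob_space_imp_sigma_finite prob_space_normal_density) auto
  show "sets (distr ?P borel ?T) = sets (student_t ?n)"
    by (simp add: student_t_def)
  fix A assume "A \<in> sets (distr ?P borel ?T)"
  then have A[measurable]: "A \<in> sets borel" by simp
  define c where "c = real ?n * unit_ball_vol (real ?n) * (2 * pi) powr (- real ?n / 2)"
  have c: "c \<ge> 0" by (simp add: c_def)
  define C where "C = (2 * pi) powr (real (Suc ?n) / 2) / (real (Suc ?n) * unit_ball_vol (real (Suc ?n)))"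
  define g where "g r = (\<integral>\<^sup>+x. indicator A (x / (r / m)) * ennreal (std_normal_density x) \<partial>lborel)" for r
  have g_meas[measurable]: "g \<in> borel_measurable borel" unfolding g_def by measurable
  have "emeasure (distr ?P borel ?T) A = (\<integral>\<^sup>+z. indicator A (?T z) \<partial>?P)"
    by (subst nn_integral_indicator[symmetric]) (simp_all only: sets_distr A, subst nn_integral_distr, auto)
  also have "\<dots> = (\<integral>\<^sup>+z. (\<integral>\<^sup>+x. indicator A (?T (z(j := x))) \<partial>?N) \<partial>?PI)"
    using I j by (intro N.product_nn_integral_insert) auto
  also have "\<dots> = (\<integral>\<^sup>+z. g (?R z) \<partial>?PI)"
  proof (rule nn_integral_cong)
    fix z :: "'a \<Rightarrow> real"
    have R: "?R (z(j := x)) = ?R z" for x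
      using j by (intro arg_cong[where f = sqrt] sum.cong) auto
    show "(\<integral>\<^sup>+x. indicator A (?T (z(j := x))) \<partial>?N) = g (?R z)"
      unfolding R g_def m_def[symmetric] by (subst nn_integral_density) (auto simp: mult.commute)
  qed
  also have "\<dots> = (\<integral>\<^sup>+r. g r * (ennreal (c * (r ^ (?n - 1) * exp (- r\<^sup>2 / 2))) * indicator {0..} r) \<partial>lborel)"
    unfolding c_def by (rule nn_integral_norm_std_normal[OF I g_meas])
  also have "\<dots> = (\<integral>\<^sup>+r. (\<integral>\<^sup>+t. indicator A t * (ennreal (c / (m * sqrt (2 * pi))) *
      (ennreal (r ^ ?n * exp (- (1 + t\<^sup>2 / real ?n) * r\<^sup>2 / 2)) * indicator {0..} r)) \<partial>lborel) \<partial>lborel)"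
  proof (rule nn_integral_cong_AE)
    \<comment> \<open>At \<open>r = 0\<close> the quotient is \<open>0\<close> by convention and the substitution breaks down.\<close>
    have "AE r in lborel. r \<noteq> (0::real)" by (rule AE_lborel_singleton)
    then show "AE r in lborel. g r * (ennreal (c * (r ^ (?n - 1) * exp (- r\<^sup>2 / 2))) * indicator {0..} r) =
      (\<integral>\<^sup>+t. indicator A t * (ennreal (c / (m * sqrt (2 * pi))) *
      (ennreal (r ^ ?n * exp (- (1 + t\<^sup>2 / real ?n) * r\<^sup>2 / 2)) * indicator {0..} r)) \<partial>lborel)"
    proof eventually_elim
      case (elim r)
      show ?case
      proof (cases "r > 0")
        case False
        then show ?thesis using elim by (simp add: indicator_def)
      next
        case r: True
        have rm: "r / m > 0" using r m by simp
        have gr: "g r = ennreal (r / m) * (\<integral>\<^sup>+t. indicator A t * ennreal (std_normal_density (r / m * t)) \<partial>lborel)"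
          unfolding g_def using r m
          by (subst nn_integral_real_affine[where c = "r / m" and t = 0]) simp_all
        have "g r * (ennreal (c * (r ^ (?n - 1) * exp (- r\<^sup>2 / 2))) * indicator {0..} r) =
          ennreal (r / m) * ennreal (c * (r ^ (?n - 1) * exp (- r\<^sup>2 / 2))) *
            (\<integral>\<^sup>+t. indicator A t * ennreal (std_normal_density (r / m * t)) \<partial>lborel)"
          using r by (simp add: gr mult_ac)
        also have "\<dots> = (\<integral>\<^sup>+t. ennreal (r / m) * ennreal (c * (r ^ (?n - 1) * exp (- r\<^sup>2 / 2))) *
             (indicator A t * ennreal (std_normal_density (r / m * t))) \<partial>lborel)"
          by (rule nn_integral_cmult[symmetric]) measurable
        also have "\<dots> = (\<integral>\<^sup>+t. indicator A t * (ennreal (c / (m * sqrt (2 * pi))) *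
             (ennreal (r ^ ?n * exp (- (1 + t\<^sup>2 / real ?n) * r\<^sup>2 / 2)) * indicator {0..} r)) \<partial>lborel)"
        proof (rule nn_integral_cong)
          fix t :: real
          have e: "exp (- r\<^sup>2 / 2) * exp (- (r / m * t)\<^sup>2 / 2) = exp (- (1 + t\<^sup>2 / real ?n) * r\<^sup>2 / 2)"
            unfolding exp_add[symmetric] m(2)[symmetric] using m(1)
            by (intro arg_cong[where f = exp]) (simp add: field_simps power2_eq_square)
          have p: "r * r ^ (?n - 1) = r ^ ?n" using n by (simp add: power_eq_if)
          have "(r / m) * (c * (r ^ (?n - 1) * exp (- r\<^sup>2 / 2))) * std_normal_density (r / m * t)
            = c / (m * sqrt (2 * pi)) * ((r * r ^ (?n - 1)) * (exp (- r\<^sup>2 / 2) * exp (- (r / m * t)\<^sup>2 / 2)))"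
            by (simp add: std_normal_density_def)
          also have "\<dots> = c / (m * sqrt (2 * pi)) * (r ^ ?n * exp (- (1 + t\<^sup>2 / real ?n) * r\<^sup>2 / 2))"
            unfolding e p ..
          finally show "ennreal (r / m) * ennreal (c * (r ^ (?n - 1) * exp (- r\<^sup>2 / 2))) *
             (indicator A t * ennreal (std_normal_density (r / m * t))) = indicator A t * (ennreal (c / (m * sqrt (2 * pi))) *
             (ennreal (r ^ ?n * exp (- (1 + t\<^sup>2 / real ?n) * r\<^sup>2 / 2)) * indicator {0..} r))"
            using rm r c m by (cases "t \<in> A") (simp_all add: ennreal_mult'[symmetric])
        qed
        finally show ?thesis .
      qed
    qed
  qed
  also have "\<dots> = (\<integral>\<^sup>+t. (\<integral>\<^sup>+r. indicator A t * (ennreal (c / (m * sqrt (2 * pi))) *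
      (ennreal (r ^ ?n * exp (- (1 + t\<^sup>2 / real ?n) * r\<^sup>2 / 2)) * indicator {0..} r)) \<partial>lborel) \<partial>lborel)"
    by (rule lborel_pair.Fubini') measurable
  also have "\<dots> = (\<integral>\<^sup>+t. ennreal (student_t_density ?n t) * indicator A t \<partial>lborel)"
  proof (rule nn_integral_cong)
    fix t :: real
    let ?a = "1 + t\<^sup>2 / real ?n"
    have a: "?a > 0" by (intro add_pos_nonneg) auto
    have "(\<integral>\<^sup>+r. indicator A t * (ennreal (c / (m * sqrt (2 * pi))) *
      (ennreal (r ^ ?n * exp (- ?a * r\<^sup>2 / 2)) * indicator {0..} r)) \<partial>lborel) =
      indicator A t * (ennreal (c / (m * sqrt (2 * pi))) *
       (\<integral>\<^sup>+r. ennreal (r ^ (Suc ?n - 1) * exp (- ?a * r\<^sup>2 / 2)) * indicator {0..} r \<partial>lborel))"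
      by (simp add: nn_integral_cmult)
    also have "\<dots> = indicator A t * (ennreal (c / (m * sqrt (2 * pi))) * ennreal (?a powr (- real (Suc ?n) / 2) * C))"
      using a unfolding C_def by (subst nn_integral_radial_gaussian) auto
    also have "\<dots> = indicator A t * ennreal (c / (m * sqrt (2 * pi)) * (?a powr (- real (Suc ?n) / 2) * C))"
      using c m by (simp add: ennreal_mult'[symmetric])
    also have "c / (m * sqrt (2 * pi)) * (?a powr (- real (Suc ?n) / 2) * C) = student_t_density ?n t"
    proof -
      define k where "k = real ?n"
      have k: "k > 0" using n by (simp add: k_def)
      have G: "Gamma (k / 2 + 1) = k / 2 * Gamma (k / 2)"
        using k by (intro Gamma_plus1) (auto elim!: nonpos_Ints_cases)
      have G': "Gamma ((k + 1) / 2 + 1) = (k + 1) / 2 * Gamma ((k + 1) / 2)"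
        using k by (intro Gamma_plus1) (auto elim!: nonpos_Ints_cases)
      have pos: "Gamma (k / 2) > 0" "Gamma ((k + 1) / 2) > 0" using k by auto
      have "(2 * pi) powr (- k / 2) * (2 * pi) powr ((k + 1) / 2) = (2 * pi) powr (1 / 2)"
        by (simp add: powr_add[symmetric] field_simps)
      then have p1: "(2 * pi) powr ((k + 1) / 2) = sqrt (2 * pi) / (2 * pi) powr (- k / 2)"
        by (simp add: powr_half_sqrt field_simps)
      have p2: "pi powr ((k + 1) / 2) = pi powr (k / 2) * sqrt pi"
        by (simp add: powr_add[symmetric] powr_half_sqrt[symmetric] add_divide_distrib)
      have alg: "k * (A / (k / 2 * G)) * P / (q * w) * (w / P / (l * (A * p / (l / 2 * H)))) = H / (q * p * G)"
        if "k > 0" "l > 0" "G > 0" "H > 0" "A > 0" "P > 0" "p > 0" "q > 0" "w > 0" for k l G H A P p q w :: real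
        using that by (simp add: field_simps)
      have "c / (m * sqrt (2 * pi)) * C = Gamma ((k + 1) / 2) / (sqrt k * sqrt pi * Gamma (k / 2))"
        unfolding c_def C_def m_def k_def[symmetric] unit_ball_vol_def of_nat_Suc add.commute[of 1] p1 p2 G G'
        using k pos by (intro alg) auto
      then have "c / (m * sqrt (2 * pi)) * C = Gamma ((k + 1) / 2) / (sqrt (k * pi) * Gamma (k / 2))"
        by (simp add: real_sqrt_mult)
      note const = this
      have "c / (m * sqrt (2 * pi)) * (?a powr (- real (Suc ?n) / 2) * C) =
          c / (m * sqrt (2 * pi)) * C * ?a powr (- real (Suc ?n) / 2)"
        by (simp only: mult_ac)
      moreover have "- real (Suc ?n) / 2 = - (real ?n + 1) / 2"
        by simp
      ultimately show ?thesis
        unfolding const student_t_density_def k_def by (simp only:)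
    qed
    finally show "(\<integral>\<^sup>+r. indicator A t * (ennreal (c / (m * sqrt (2 * pi))) *
      (ennreal (r ^ ?n * exp (- ?a * r\<^sup>2 / 2)) * indicator {0..} r)) \<partial>lborel) =
      ennreal (student_t_density ?n t) * indicator A t" by (simp add: mult.commute)
  qed
  also have "\<dots> = emeasure (student_t ?n) A"
    unfolding student_t_def by (subst emeasure_density) (auto simp: student_t_density_def)
  finally show "emeasure (distr ?P borel ?T) A = emeasure (student_t ?n) A" .
qed

section \<open>Central intervals of Student's distribution\<close>

lemma borel_measurable_student_t_density[measurable]: "student_t_density n \<in> borel_measurable borel"
  unfolding student_t_density_def by measurable

text \<open>That the density has total mass one is inherited from the ratio representation.\<close>
lemma real_distribution_student_t:
  assumes "n \<ge> 1"
  shows "real_distribution (student_t n)"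
proof -
  interpret P: prob_space "Pi\<^sub>M (insert n {..<n}) (\<lambda>_. std_normal_distribution)"
    by (intro prob_space_PiM prob_space_normal_density) auto
  have ne: "{..<n} \<noteq> {}" using assms by (auto simp: lessThan_empty_iff)
  show ?thesis
    using distr_student_ratio[of "{..<n}" n] ne
      P.real_distribution_distr[of "\<lambda>z. z n / (sqrt (\<Sum>i\<in>{..<n}. (z i)\<^sup>2) / sqrt (real (card {..<n})))"]
    by simp
qed

lemma student_t_symmetric:
  assumes [measurable]: "A \<in> sets borel"
  shows "measure (student_t n) (uminus -` A) = measure (student_t n) A"
proof -
  have "emeasure (student_t n) (uminus -` A) =
      (\<integral>\<^sup>+x. ennreal (student_t_density n x) * indicator (uminus -` A) x \<partial>lborel)"
    unfolding student_t_def using measurable_sets[of uminus borel borel A] by (intro emeasure_density) auto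
  also have "\<dots> = (\<integral>\<^sup>+x. ennreal (student_t_density n (- x)) * indicator A (- x) \<partial>lborel)"
    by (intro nn_integral_cong) (auto simp: student_t_density_def indicator_def)
  also have "\<dots> = (\<integral>\<^sup>+x. ennreal (student_t_density n x) * indicator A x \<partial>lborel)"
    by (subst (2) nn_integral_real_affine[where c = "-1" and t = 0]) auto
  also have "\<dots> = emeasure (student_t n) A"
    unfolding student_t_def by (intro emeasure_density[symmetric]) auto
  finally show ?thesis by (simp add: measure_def)
qed

text \<open>
  The quantile is an infimum, so right continuity of the distribution function gives
  \<open>P(T \<le> t) \<ge> 1 - \<alpha>/2\<close>, and symmetry turns the upper tail into both tails. It is nonnegative because a negative
  point has at most mass \<open>1/2\<close> to its left.
\<close>
lemma student_t_central_interval: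
  assumes n: "n \<ge> 1" and \<alpha>: "0 < \<alpha>" "\<alpha> < 1"
  defines "t \<equiv> t_quantile n (1 - \<alpha> / 2)"
  shows "0 \<le> t" and "1 - \<alpha> \<le> measure (student_t n) {-t..t}"
proof -
  let ?D = "student_t n" and ?q = "1 - \<alpha> / 2"
  interpret D: real_distribution ?D using n by (rule real_distribution_student_t)
  have sD[simp]: "sets ?D = sets borel" by simp
  define S where "S = {x. ?q \<le> cdf ?D x}"
  have t: "t = Inf S" by (simp add: t_def t_quantile_def quantile_def S_def)
  have nonneg: "0 \<le> x" if "x \<in> S" for x
  proof (rule ccontr)
    assume "\<not> 0 \<le> x"
    have "measure ?D {..x} = measure ?D (uminus -` {..x})"
      by (rule student_t_symmetric[symmetric]) simp
    also have "uminus -` {..x} = {-x..}" by auto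
    finally have "2 * measure ?D {..x} = measure ?D {..x} + measure ?D {-x..}" by simp
    also have "\<dots> = measure ?D ({..x} \<union> {-x..})"
      using \<open>\<not> 0 \<le> x\<close> by (intro D.finite_measure_Union[symmetric]) auto
    also have "\<dots> \<le> 1" by (rule D.prob_le_1)
    finally show False using that \<alpha> by (simp add: S_def cdf_def)
  qed
  have "eventually (\<lambda>x. ?q < cdf ?D x) at_top"
    using D.cdf_lim_at_top_prob \<alpha> by (intro order_tendstoD) auto
  then obtain x0 where "?q < cdf ?D x0" by (auto simp: eventually_at_top_linorder)
  then have ne: "S \<noteq> {}" by (auto simp: S_def intro: less_imp_le)
  have bdd: "bdd_below S" using nonneg by (intro bdd_belowI)
  show t0: "0 \<le> t" unfolding t using ne nonneg by (intro cInf_greatest)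
  have above: "?q \<le> cdf ?D y" if y: "y > t" for y
  proof -
    obtain x where x: "x \<in> S" "x < y" using cInf_lessD[OF ne, of y] y unfolding t by blast
    then have "cdf ?D x \<le> cdf ?D y" by (intro D.cdf_nondecreasing) auto
    then show ?thesis using x(1) by (simp add: S_def)
  qed
  have "eventually (\<lambda>y. ?q \<le> cdf ?D y) (at_right t)"
    using eventually_at_right_less[of t] by eventually_elim (rule above)
  moreover have "(cdf ?D \<longlongrightarrow> cdf ?D t) (at_right t)"
    using D.cdf_is_right_cont[of t] by (simp add: continuous_within)
  ultimately have q: "?q \<le> cdf ?D t" by (intro tendsto_lowerbound) auto
  have "measure ?D {..< -t} = measure ?D (uminus -` {t<..})"
    by (intro arg_cong[where f = "measure ?D"]) auto
  also have "\<dots> = measure ?D {t<..}" by (rule student_t_symmetric) simp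
  finally have sym: "measure ?D {..< -t} = measure ?D {t<..}" .
  have "{..t} \<union> {t<..} = space ?D" by auto
  then have "1 = measure ?D ({..t} \<union> {t<..})" by (simp only: D.prob_space)
  also have "\<dots> = measure ?D {..t} + measure ?D {t<..}"
    by (intro D.finite_measure_Union) auto
  finally have up: "measure ?D {t<..} \<le> \<alpha> / 2" using q by (simp add: cdf_def)
  have "{..t} = {..< -t} \<union> {-t..t}" using t0 by auto
  then have "measure ?D {..t} = measure ?D ({..< -t} \<union> {-t..t})" by simp
  also have "\<dots> = measure ?D {..< -t} + measure ?D {-t..t}"
    by (intro D.finite_measure_Union) auto
  finally show "1 - \<alpha> \<le> measure ?D {-t..t}" using q up sym by (simp add: cdf_def)
qed

section \<open>The coverage probability\<close>

text \<open>
  Vectors that are orthogonal for the covariance form give independent scores, whatever their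
  position with respect to the inner product; the unknown \<open>\<sigma>\<close> cancels from the ratio.
\<close>
lemma gaussian_student_ratio:
  fixes M :: "'a::{real_inner, polish_space} measure"
  assumes M: "gaussian_measure M \<zeta> (\<lambda>x. \<sigma>\<^sup>2 *\<^sub>R Q x)" and \<sigma>: "\<sigma> > 0" and Q: "linear Q"
    and B: "finite B" "B \<noteq> {}" "c \<notin> B"
    and pos: "\<And>e. e \<in> insert c B \<Longrightarrow> inner (Q e) e > 0"
    and orth: "\<And>e d. e \<in> insert c B \<Longrightarrow> d \<in> insert c B \<Longrightarrow> e \<noteq> d \<Longrightarrow> inner (Q e) d = 0"
  defines "X e y \<equiv> inner e (y - \<zeta>) / (\<sigma> * sqrt (inner (Q e) e))"
  shows "distr M borel (\<lambda>y. X c y / (sqrt (\<Sum>e\<in>B. (X e y)\<^sup>2) / sqrt (real (card B)))) = student_t (card B)"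
proof -
  let ?J = "insert c B"
  define g where "g e = inverse (\<sigma> * sqrt (inner (Q e) e)) *\<^sub>R e" for e
  have X: "X e y = inner (g e) (y - \<zeta>)" for e y by (simp add: X_def g_def divide_inverse mult.commute)
  have sM[measurable_cong]: "sets M = sets borel" using M by (simp add: gaussian_measure_def)
  have [measurable]: "X e \<in> borel_measurable M" for e unfolding X_def by measurable
  have C: "linear (\<lambda>x. \<sigma>\<^sup>2 *\<^sub>R Q x)" using Q by (rule linear_compose_scale_right)
  have law: "distr M (Pi\<^sub>M ?J (\<lambda>_. borel)) (\<lambda>y. \<lambda>e\<in>?J. X e y) = Pi\<^sub>M ?J (\<lambda>_. std_normal_distribution)"
    unfolding X
  proof (rule gaussian_measure_iid_scores[OF M C])
    show "finite ?J" using B by simp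
    fix e d assume ed: "e \<in> ?J" "d \<in> ?J"
    have "inner (\<sigma>\<^sup>2 *\<^sub>R Q (g e)) (g d) =
        \<sigma>\<^sup>2 * (inverse (\<sigma> * sqrt (inner (Q e) e)) * (inverse (\<sigma> * sqrt (inner (Q d) d)) * inner (Q e) d))"
      by (simp add: g_def linear_cmul[OF Q])
    also have "\<dots> = (if e = d then 1 else 0)"
      using orth[OF ed] pos[OF ed(1)] \<sigma> by (auto simp: field_simps power2_eq_square)
    finally show "inner (\<sigma>\<^sup>2 *\<^sub>R Q (g e)) (g d) = (if e = d then 1 else 0)" .
  qed
  let ?ratio = "\<lambda>z. z c / (sqrt (\<Sum>e\<in>B. (z e)\<^sup>2) / sqrt (real (card B)))"
  have "student_t (card B) = distr (Pi\<^sub>M ?J (\<lambda>_. std_normal_distribution)) borel ?ratio"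
    by (rule distr_student_ratio[OF B, symmetric])
  also have "\<dots> = distr M borel (?ratio \<circ> (\<lambda>y. \<lambda>e\<in>?J. X e y))"
    unfolding law[symmetric] by (subst distr_distr) auto
  also have "?ratio \<circ> (\<lambda>y. \<lambda>e\<in>?J. X e y) = (\<lambda>y. X c y / (sqrt (\<Sum>e\<in>B. (X e y)\<^sup>2) / sqrt (real (card B))))"
    by (simp add: o_def)
  finally show ?thesis ..
qed

text \<open>
  Excludes the null event that the denominator of the Student ratio vanishes, where the quotient is \<open>0\<close> by
  convention and says nothing about its numerator.
\<close>
lemma gaussian_measure_inner_neq_mean:
  assumes M: "gaussian_measure M \<zeta> C" and v: "inner (C e) e > 0"
  shows "AE y in M. inner e y \<noteq> inner e \<zeta>"
proof -
  have sM[measurable_cong]: "sets M = sets borel" using M by (simp add: gaussian_measure_def)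
  have "AE x in normal_law (inner e \<zeta>) (inner (C e) e). x \<noteq> inner e \<zeta>"
  proof -
    have "AE x in lborel. 0 < ennreal (normal_density (inner e \<zeta>) (sqrt (inner (C e) e)) x) \<longrightarrow> x \<noteq> inner e \<zeta>"
      using AE_lborel_singleton[of "inner e \<zeta>"] by eventually_elim simp
    then have "AE x in density lborel (\<lambda>x. ennreal (normal_density (inner e \<zeta>) (sqrt (inner (C e) e)) x)).
        x \<noteq> inner e \<zeta>"
      by (subst AE_density) auto
    moreover have "inner (C e) e \<noteq> 0" using v by simp
    ultimately show ?thesis unfolding normal_law_def by (simp only: if_False)
  qed
  moreover have "normal_law (inner e \<zeta>) (inner (C e) e) = distr M borel (inner e)"
    using M by (simp add: gaussian_measure_def)
  ultimately have "AE x in distr M borel (inner e). x \<noteq> inner e \<zeta>" by (simp only:)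
  then show ?thesis by (rule AE_distrD[rotated]) measurable
qed

theorem theorem8p1:
  fixes U :: "'a::{real_inner, polish_space} set"
    and Q :: "'a \<Rightarrow> 'a"
    and \<Theta> :: "('a \<times> real) set"
    and P :: "'a \<times> real \<Rightarrow> 'a measure"
    and zeta_hat :: "'a \<Rightarrow> 'a"
    and \<tau> lam :: real and n :: nat
    and s_hat :: "'a \<Rightarrow> real"
    and b :: 'a and \<alpha> :: real
  assumes "subspace U" and "closed U"
    and "bounded_linear Q" and "nonneg_operator Q" and "self_adjoint Q" and "nuclear Q"
    and "invariant_under Q U" and "invariant_under Q (orthogonal_comp U)"
    and "\<Theta> = U \<times> {0<..}"
    and "\<And>\<zeta> \<sigma>. (\<zeta>, \<sigma>) \<in> \<Theta> \<Longrightarrow> gaussian_measure (P (\<zeta>, \<sigma>)) \<zeta> (\<lambda>x. \<sigma>\<^sup>2 *\<^sub>R Q x)"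
    and "\<And>y. zeta_hat y = orth_proj U y"
    and "(\<lambda>x. Q (x - orth_proj U x)) \<noteq> (\<lambda>x. 0)"
    and "\<tau> = operator_trace (\<lambda>x. Q (x - orth_proj U x))"
    and "lam = onorm (\<lambda>x. Q (x - orth_proj U x))"
    and "n = dim {x. lam *\<^sub>R x - Q (x - orth_proj U x) = 0}"
    and "\<And>y. 0 \<le> s_hat y"
    and "\<And>y. (s_hat y)\<^sup>2 =
           (norm (y - zeta_hat y))\<^sup>2 / operator_trace (\<lambda>x. Q (x - orth_proj U x))"
    and "0 < inner (Q b) (orth_proj U b)"
    and "0 < \<alpha>" and "\<alpha> < 1"
  shows "confidence_interval \<Theta> P (\<lambda>(\<zeta>, \<sigma>). inner b \<zeta>)
           (\<lambda>y. pm_interval (inner b (zeta_hat y))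
                  (sqrt (\<tau> / (lam * real n)) * t_quantile n (1 - \<alpha> / 2) * s_hat y
                     * sqrt (inner (Q b) (orth_proj U b))))
           (1 - \<alpha>)"
proof -
  note U = assms(1,2) and sigma_model = assms(9,10)
  let ?P = "orth_proj U"
  let ?T = "\<lambda>x. Q (x - ?P x)"
  define v where "v = inner (Q b) (?P b)"
  define t where "t = t_quantile n (1 - \<alpha> / 2)"
  have v: "v > 0" using assms(18) by (simp add: v_def)
  have blP: "bounded_linear ?P" using U by (rule bounded_linear_orth_proj)
  have Q: "linear Q" using assms(3) by (rule bounded_linear.linear)
  have nucT: "nuclear ?T" using U assms(6) by (rule nuclear_compl_operator)
  have blT: "bounded_linear ?T" using nucT by (simp add: nuclear_def)
  have T: "self_adjoint ?T" "nonneg_operator ?T"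
    using compl_operator_self_adjoint_nonneg[OF U Q assms(5,4,7,8)] by blast+
  have tau: "\<tau> > 0"
    unfolding assms(13) using nucT T assms(12) by (rule operator_trace_pos)
  have lam: "lam > 0"
    using onorm_pos_lt[OF blT] assms(12) by (auto simp: assms(14))
  obtain B where B: "finite B" "orthonormal_set B" "card B = n"
    and spanB: "span B = {x. lam *\<^sub>R x - ?T x = 0}"
    using eigenspace_orthonormal_basis[OF nucT lam] unfolding assms(15)[symmetric] .
  obtain w where "w \<noteq> 0" "?T w = lam *\<^sub>R w"
    using onorm_eigenvector[OF nucT T assms(12)] unfolding assms(14)[symmetric] .
  then have "w \<in> span B" by (simp add: spanB)
  then have Bne: "B \<noteq> {}" using \<open>w \<noteq> 0\<close> by auto
  then have n: "n \<ge> 1" using B by (metis One_nat_def Suc_leI card_gt_0_iff)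
  have eig: "?T e = lam *\<^sub>R e" if "e \<in> B" for e
    using span_base[OF that] by (simp add: spanB)
  have Bcompl: "e \<in> orthogonal_comp U" if "e \<in> B" for e
  proof -
    have "?T e \<in> orthogonal_comp U"
      using assms(8) orth_proj_compl[OF U] unfolding invariant_under_def by blast
    then have "inverse lam *\<^sub>R ?T e \<in> orthogonal_comp U"
      by (rule subspace_mul[OF subspace_orthogonal_comp])
    then show ?thesis using lam by (simp add: eig[OF that])
  qed
  have Uorth: "inner u e = 0" "inner e u = 0" if "u \<in> U" "e \<in> B" for u e
    using Bcompl[OF that(2)] that(1) by (auto simp: orthogonal_comp_def orthogonal_def inner_commute)
  have QB: "Q e = lam *\<^sub>R e" if "e \<in> B" for e
    using eig[OF that] orth_proj_zero[OF U Bcompl[OF that]] by simp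
  have PbU: "?P b \<in> U" by (rule orth_proj_in[OF U])
  have QPbU: "Q (?P b) \<in> U" using assms(7) PbU unfolding invariant_under_def by blast
  have vPb: "inner (Q (?P b)) (?P b) = v"
    using orth_proj_commutes_invariant[OF U Q assms(7,8), of b] inner_orth_proj[OF U, of "Q b" b]
      inner_orth_proj_swap[OF U, of "Q b" "?P b"] orth_proj_ident[OF U PbU] by (simp add: v_def)
  \<comment> \<open>The numerator vector has to be distinct from the basis vectors to serve as an extra index.\<close>
  have PbB: "?P b \<notin> B"
    using Uorth(1)[OF PbU, of "?P b"] v vPb inner_eq_zero_iff[of "?P b"] by auto
  have pos: "inner (Q e) e > 0" if "e \<in> insert (?P b) B" for e
    using that v lam vPb QB B(2) by (auto simp: orthonormal_set_inner)
  have orth: "inner (Q e) d = 0" if "e \<in> insert (?P b) B" "d \<in> insert (?P b) B" "e \<noteq> d" for e d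
    using that QB Uorth[OF PbU] Uorth[OF QPbU] B(2) by (auto simp: orthonormal_set_inner)
  have t: "0 \<le> t" "1 - \<alpha> \<le> measure (student_t n) {-t..t}"
    unfolding t_def using student_t_central_interval[OF n assms(19,20)] by blast+
  have s_hat: "s_hat y = norm (y - ?P y) / sqrt \<tau>" for y
    using assms(16)[of y] assms(17)[of y] tau unfolding assms(11) assms(13)[symmetric]
    by (metis norm_ge_zero real_sqrt_divide real_sqrt_unique)
  define r where "r y = sqrt (\<tau> / (lam * real n)) * t * s_hat y * sqrt v" for y
  have r: "r y = t * sqrt v * norm (y - ?P y) / (sqrt lam * sqrt (real n))" for y
    using tau by (simp add: r_def s_hat real_sqrt_divide real_sqrt_mult)
  show ?thesis
    unfolding confidence_interval_def v_def[symmetric] t_def[symmetric] r_def[symmetric] assms(11)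
  proof
    fix \<theta> assume "\<theta> \<in> \<Theta>"
    then obtain \<zeta> \<sigma> where \<theta>: "\<theta> = (\<zeta>, \<sigma>)" and \<zeta>: "\<zeta> \<in> U" and \<sigma>: "\<sigma> > 0"
      by (auto simp: sigma_model(1))
    define M where "M = P \<theta>"
    have M: "gaussian_measure M \<zeta> (\<lambda>x. \<sigma>\<^sup>2 *\<^sub>R Q x)"
      using sigma_model(2) \<open>\<theta> \<in> \<Theta>\<close> by (simp add: M_def \<theta>)
    interpret prob_space M using M by (simp add: gaussian_measure_def)
    have sM[measurable_cong]: "sets M = sets borel" using M by (simp add: gaussian_measure_def)
    have spM: "space M = UNIV" using sets_eq_imp_space_eq[OF sM] by simp
    have [measurable]: "?P \<in> borel_measurable borel"
      by (rule borel_measurable_continuous_onI[OF linear_continuous_on[OF blP]])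
    let ?C = "{y \<in> space M. inner b \<zeta> \<in> pm_interval (inner b (?P y)) (r y)}"
    have C[measurable]: "?C \<in> events"
      unfolding pm_interval_def r atLeastAtMost_iff by measurable
    define X where "X e y = inner e (y - \<zeta>) / (\<sigma> * sqrt (inner (Q e) e))" for e y
    have [measurable]: "X e \<in> borel_measurable M" for e unfolding X_def by measurable
    define R where "R y = sqrt (\<Sum>e\<in>B. (X e y)\<^sup>2)" for y
    have [measurable]: "R \<in> borel_measurable M" unfolding R_def by measurable
    define S where "S y = X (?P b) y / (R y / sqrt (real n))" for y
    have [measurable]: "S \<in> borel_measurable M" unfolding S_def by measurable
    have law: "distr M borel S = student_t n"
      using gaussian_student_ratio[OF M \<sigma> Q B(1) Bne PbB pos orth]
      unfolding X_def[symmetric] R_def[symmetric] B(3) S_def[symmetric] .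
    \<comment> \<open>Bessel's inequality: the only step that loses probability.\<close>
    have R_le: "R y \<le> norm (y - ?P y) / (\<sigma> * sqrt lam)" for y
    proof -
      have "X e y = inner e (y - ?P y) / (\<sigma> * sqrt lam)" if "e \<in> B" for e
        using Uorth(2)[OF \<zeta> that] Uorth(2)[OF orth_proj_in[OF U] that, of y] QB[OF that] B(2) that
        by (simp add: X_def inner_diff_right orthonormal_set_inner)
      then have "R y = sqrt ((\<Sum>e\<in>B. (inner e (y - ?P y))\<^sup>2) / (\<sigma> * sqrt lam)\<^sup>2)"
        unfolding R_def by (simp add: power_divide sum_divide_distrib)
      also have "\<dots> \<le> sqrt ((norm (y - ?P y))\<^sup>2 / (\<sigma> * sqrt lam)\<^sup>2)"
        by (intro real_sqrt_le_mono divide_right_mono bessel_inequality B) simp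
      also have "\<dots> = norm (y - ?P y) / (\<sigma> * sqrt lam)"
        using \<sigma> lam by (simp add: real_sqrt_divide abs_mult del: power_mult_distrib)
      finally show ?thesis .
    qed
    have cover: "y \<in> ?C" if "\<bar>S y\<bar> \<le> t" "R y \<noteq> 0" for y
    proof -
      have Rp: "R y > 0" using that(2) by (simp add: R_def less_le sum_nonneg)
      have "\<bar>X (?P b) y\<bar> = \<bar>S y\<bar> * (R y / sqrt (real n))"
        using Rp n by (simp add: S_def abs_mult)
      also have "\<dots> \<le> t * (norm (y - ?P y) / (\<sigma> * sqrt lam) / sqrt (real n))"
        using that(1) t(1) Rp R_le[of y] by (intro mult_mono divide_right_mono) auto
      finally have "\<bar>X (?P b) y\<bar> * (\<sigma> * sqrt v) \<le>
          t * (norm (y - ?P y) / (\<sigma> * sqrt lam) / sqrt (real n)) * (\<sigma> * sqrt v)"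
        using \<sigma> v by (intro mult_right_mono) auto
      also have "\<dots> = r y" using \<sigma> by (simp add: r)
      also have "\<bar>X (?P b) y\<bar> * (\<sigma> * sqrt v) = \<bar>inner (?P b) (y - \<zeta>)\<bar>"
        using \<sigma> v by (simp add: X_def vPb abs_mult)
      also have "inner (?P b) (y - \<zeta>) = inner b (?P y) - inner b \<zeta>"
        using orth_proj_ident[OF U \<zeta>] by (simp add: inner_diff_right inner_orth_proj_swap[OF U])
      finally show ?thesis by (auto simp: pm_interval_def spM)
    qed
    obtain e where e: "e \<in> B" using Bne by blast
    have "AE y in M. inner e y \<noteq> inner e \<zeta>"
      using pos[of e] e \<sigma> by (intro gaussian_measure_inner_neq_mean[OF M]) simp
    then have R0: "AE y in M. R y \<noteq> 0"
    proof eventually_elim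
      case (elim y)
      then have "X e y \<noteq> 0" using pos[of e] e \<sigma> by (simp add: X_def inner_diff_right)
      then show ?case using B(1) e by (auto simp: R_def sum_nonneg_eq_0_iff)
    qed
    have "1 - \<alpha> \<le> measure (distr M borel S) {-t..t}" using t(2) by (simp add: law)
    also have "\<dots> = prob (S -` {-t..t} \<inter> space M)" by (rule measure_distr) auto
    also have "\<dots> \<le> prob ?C"
    proof (rule finite_measure_mono_AE[OF _ C])
      show "AE y in M. y \<in> S -` {-t..t} \<inter> space M \<longrightarrow> y \<in> ?C"
        using R0
      proof eventually_elim
        case (elim y)
        show ?case
        proof
          assume "y \<in> S -` {-t..t} \<inter> space M"
          then have "\<bar>S y\<bar> \<le> t" by auto
          then show "y \<in> ?C" using elim by (rule cover)
        qed
      qed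
    qed
    finally have "1 - \<alpha> \<le> prob ?C" .
    with C show "{y \<in> space (P \<theta>). (case \<theta> of (\<zeta>, \<sigma>) \<Rightarrow> inner b \<zeta>) \<in> pm_interval (inner b (?P y)) (r y)} \<in> sets (P \<theta>) \<and>
        1 - \<alpha> \<le> \<P>(y in P \<theta>. (case \<theta> of (\<zeta>, \<sigma>) \<Rightarrow> inner b \<zeta>) \<in> pm_interval (inner b (?P y)) (r y))"
      by (simp add: M_def \<theta>)
  qed
qed

end
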